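(* Let $q_i:\mathbb R^n\to\mathbb R$, $i\in E\cup I$, be twice continuously differentiable, where $E=\{1,\dots,\ell_1\}$, $I=\{\ell_1+1,\dots,\ell_1+\ell_2\}$, $\ell=\ell_1+\ell_2$, $E\cup I\neq\emptyset$, $q=(q_1,\dots,q_\ell)$, $\Theta=\{0_{\mathbb R^{\ell_1}}\}\times\mathbb R_-^{\ell_2}$ and $\Gamma=\{x\in\mathbb R^n\mid q(x)\in\Theta\}$. Suppose that RCRCQ holds at $\bar x\in\Gamma$. Then there exist an open neighborhood $U$ of $\bar x$ and a real number $\gamma>0$ such that MSCQ holds at every point $x\in\Gamma\cap U$ with modulus $\gamma$, and moreover: (i) For every $x\in\Gamma\cap U$ and all $x^*,v\in\mathbb R^n$ satisfying $\langle\nabla q_i(x),v\rangle=0$ for all $i\in E\cup I^+(x,x^* )$, we have $\Lambda(x,x^*;v)=\Lambda(x,x^* )$. (ii) For every $x\in\Gamma\cap U$, $x^*\in\mathbb R^n$ and $\lambda\in\Lambda(x,x^* )$, $$T_{\mathrm{gph}\,N_\Gamma}(x,x^* )=\big\{(w,z)\in\mathbb R^{2n}\mid z\in\nabla^2\langle\lambda,q\rangle(x)w+N_{K(x,x^* )}(w)\big\},$$ equivalently $DN_\Gamma(x,x^* )(w)=\nabla^2\langle\lambda,q\rangle(x)w+N_{K(x,x^* )}(w)$ for all $w\in\mathbb R^n$. (iii) For every $x\in\Gamma\cap U$ and $x^*\in\mathbb R^n$ with $\Lambda(x,x^* )\neq\emptyset$, there exists $\lambda\in\Lambda(x,x^*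 )$ with $\|\lambda\|\le\gamma\|x^*\|$ such that $z\in\nabla^2\langle\lambda,q\rangle(x)w+N_{K(x,x^* )}(w)$ whenever $w\in\mathbb R^n$ and $z\in DN_\Gamma(x,x^* )(w)$.
   Context: For $x\in\Gamma$, $I(x)=\{i\in I\mid q_i(x)=0\}$ is the active index set. RCRCQ holds at $\bar x\in\Gamma$ if there is a neighborhood $V$ of $\bar x$ such that for every $J\subseteq I(\bar x)$ the family $\{\nabla q_i(x)\mid i\in E\cup J\}$ has the same rank for all $x\in V$. MSCQ holds at $x\in\Gamma$ with modulus $\gamma>0$ if there is a neighborhood $W$ of $x$ with $d(u;\Gamma)\le\gamma\, d(q(u);\Theta)$ for all $u\in W$. $\nabla^2\langle\lambda,q\rangle(x)=\sum_i\lambda_i\nabla^2q_i(x)$. Tangent cone: $T_\Omega(\bar z)=\{u\mid\exists t_k\downarrow0,u_k\to u,\ \bar z+t_ku_k\in\Omega\}$. Regular normal cone $\widehat N_\Omega(z)=\{z^*\mid\limsup_{y\to z, y\in\Omega}\langle z^*,y-z\rangle/\|y-z\|\le0\}$; limiting normal cone $N_\Omega(\bar z)$ = set of limits of $z_k^*\in\widehat N_\Omega(z_k)$ with $z_k\to\bar z$, $z_k\in\Omega$ (empty if $\bar z\notin\Omega$). For a set-valued map $\Phi$, the graphical derivative is $D\Phi(x,y)(u)=\{v\mid(u,v)\in T_{\mathrm{gph}\Phi}(x,y)\}$. For $x\in\Gamma$ and $x^*\in\mathbb R^n$: $\Lambda(x,x^* )=\{\lambda\in\mathbb R^\ell\mid\sum_{i\in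 E\cup I}\lambda_i\nabla q_i(x)=x^*,\ \lambda_i\ge0,\ \lambda_iq_i(x)=0\ (i\in I)\}$; $I^+(\lambda)=\{i\in I\mid\lambda_i>0\}$; $I^+(x,x^* )=\bigcup_{\lambda\in\Lambda(x,x^* )}I^+(\lambda)$; $K(x,x^* )=T_\Gamma(x)\cap\{x^*\}^\perp$ (critical cone); for $v\in\mathbb R^n$, $\Lambda(x,x^*;v)=\mathrm{argmax}\{\langle v,\nabla^2\langle\lambda,q\rangle(x)v\rangle\mid\lambda\in\Lambda(x,x^* )\}$. *)

theory Defs
  imports "HOL-Analysis.Analysis"
begin

definition tangent_cone :: "'a::real_normed_vector set \<Rightarrow> 'a \<Rightarrow> 'a set" where
  "tangent_cone \<Omega> z = {u. \<exists>t uu. (\<forall>k. t k > (0::real)) \<and> t \<longlonglongrightarrow> 0 \<and> uu \<longlonglongrightarrow> u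
        \<and> (\<forall>k. z + t k *\<^sub>R uu k \<in> \<Omega>)}"

definition regular_normal_cone :: "'a::real_inner set \<Rightarrow> 'a \<Rightarrow> 'a set" where
  "regular_normal_cone \<Omega> z =
     {zs. Limsup (at z within \<Omega>) (\<lambda>y. ereal (inner zs (y - z) / norm (y - z))) \<le> 0}"

definition normal_cone :: "'a::real_inner set \<Rightarrow> 'a \<Rightarrow> 'a set" where
  "normal_cone \<Omega> zb = {zs. zb \<in> \<Omega> \<and> (\<exists>zk zsk. (\<forall>k. zk k \<in> \<Omega> \<and> zsk k \<in> regular_normal_cone \<Omega> (zk k))
        \<and> zk \<longlonglongrightarrow> zb \<and> zsk \<longlonglongrightarrow> zs)}"

definition graph :: "('a \<Rightarrow> 'b set) \<Rightarrow> ('a \<times> 'b) set" where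
  "graph \<Phi> = {(x, y). y \<in> \<Phi> x}"

definition graph_deriv :: "('a::real_normed_vector \<Rightarrow> 'b::real_normed_vector set) \<Rightarrow> 'a \<Rightarrow> 'b \<Rightarrow> 'a \<Rightarrow> 'b set" where
  "graph_deriv \<Phi> x y u = {v. (u, v) \<in> tangent_cone (graph \<Phi>) (x, y)}"

text \<open>Constraints q i, i in the finite index type 'm, which is partitioned into the
  equality indices E and the inequality indices I.  Theta = {0}^E x (R_-)^I in R^'m.\<close>

definition qvec :: "('m::finite \<Rightarrow> real^'n \<Rightarrow> real) \<Rightarrow> real^'n \<Rightarrow> real^'m" where
  "qvec q x = (\<chi> i. q i x)"

definition Theta :: "'m::finite set \<Rightarrow> 'm set \<Rightarrow> (real^'m) set" where
  "Theta E I = {y. (\<forall>i\<in>E. y $ i = 0) \<and> (\<forall>i\<in>I. y $ i \<le> 0)}"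

definition Gamma :: "('m::finite \<Rightarrow> real^'n \<Rightarrow> real) \<Rightarrow> 'm set \<Rightarrow> 'm set \<Rightarrow> (real^'n) set" where
  "Gamma q E I = {x. qvec q x \<in> Theta E I}"

definition active_set :: "('m \<Rightarrow> real^'n \<Rightarrow> real) \<Rightarrow> 'm set \<Rightarrow> real^'n \<Rightarrow> 'm set" where
  "active_set q I x = {i\<in>I. q i x = 0}"

definition RCRCQ :: "('m::finite \<Rightarrow> real^'n \<Rightarrow> real) \<Rightarrow> ('m \<Rightarrow> real^'n \<Rightarrow> real^'n)
     \<Rightarrow> 'm set \<Rightarrow> 'm set \<Rightarrow> real^'n \<Rightarrow> bool" where
  "RCRCQ q gq E I xb \<longleftrightarrow> xb \<in> Gamma q E I \<and>
     (\<exists>V. open V \<and> xb \<in> V \<and> (\<forall>J. J \<subseteq> active_set q I xb \<longrightarrow>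
        (\<forall>x\<in>V. \<forall>y\<in>V. dim ((\<lambda>i. gq i x) ` (E \<union> J)) = dim ((\<lambda>i. gq i y) ` (E \<union> J)))))"

definition MSCQ :: "('m::finite \<Rightarrow> real^'n \<Rightarrow> real) \<Rightarrow> 'm set \<Rightarrow> 'm set \<Rightarrow> real \<Rightarrow> real^'n \<Rightarrow> bool" where
  "MSCQ q E I \<gamma> x \<longleftrightarrow> x \<in> Gamma q E I \<and> \<gamma> > 0 \<and>
     (\<exists>W. open W \<and> x \<in> W \<and>
        (\<forall>u\<in>W. infdist u (Gamma q E I) \<le> \<gamma> * infdist (qvec q u) (Theta E I)))"

definition hess_lag :: "('m::finite \<Rightarrow> real^'n \<Rightarrow> real^'n^'n) \<Rightarrow> real^'m \<Rightarrow> real^'n \<Rightarrow> real^'n^'n" where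
  "hess_lag hq lam x = (\<Sum>i\<in>UNIV. lam $ i *\<^sub>R hq i x)"

definition multipliers :: "('m::finite \<Rightarrow> real^'n \<Rightarrow> real) \<Rightarrow> ('m \<Rightarrow> real^'n \<Rightarrow> real^'n)
     \<Rightarrow> 'm set \<Rightarrow> real^'n \<Rightarrow> real^'n \<Rightarrow> (real^'m) set" where
  "multipliers q gq I x xs = {lam. (\<Sum>i\<in>UNIV. lam $ i *\<^sub>R gq i x) = xs \<and>
        (\<forall>i\<in>I. lam $ i \<ge> 0 \<and> lam $ i * q i x = 0)}"

definition Iplus_lam :: "'m set \<Rightarrow> real^'m \<Rightarrow> 'm set" where
  "Iplus_lam I lam = {i\<in>I. lam $ i > 0}"

definition Iplus :: "('m::finite \<Rightarrow> real^'n \<Rightarrow> real) \<Rightarrow> ('m \<Rightarrow> real^'n \<Rightarrow> real^'n)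
     \<Rightarrow> 'm set \<Rightarrow> real^'n \<Rightarrow> real^'n \<Rightarrow> 'm set" where
  "Iplus q gq I x xs = (\<Union>lam\<in>multipliers q gq I x xs. Iplus_lam I lam)"

definition critical_cone :: "('m::finite \<Rightarrow> real^'n \<Rightarrow> real) \<Rightarrow> 'm set \<Rightarrow> 'm set
     \<Rightarrow> real^'n \<Rightarrow> real^'n \<Rightarrow> (real^'n) set" where
  "critical_cone q E I x xs = tangent_cone (Gamma q E I) x \<inter> {u. inner xs u = 0}"

definition multipliers_dir :: "('m::finite \<Rightarrow> real^'n \<Rightarrow> real) \<Rightarrow> ('m \<Rightarrow> real^'n \<Rightarrow> real^'n)
     \<Rightarrow> ('m \<Rightarrow> real^'n \<Rightarrow> real^'n^'n) \<Rightarrow> 'm set \<Rightarrow> real^'n \<Rightarrow> real^'n \<Rightarrow> real^'n \<Rightarrow> (real^'m) set" where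
  "multipliers_dir q gq hq I x xs v =
     {lam \<in> multipliers q gq I x xs. \<forall>mu \<in> multipliers q gq I x xs.
        inner v (hess_lag hq mu x *v v) \<le> inner v (hess_lag hq lam x *v v)}"

end

theory Submission
  imports Defs
begin

text \<open>
  Each family of gradients indexed by \<open>E \<union> J\<close> has constant rank near the reference point.  This has
  three consequences.  First, a direction orthogonal to such a family is tangent to the common zero set
  of its functions: a maximal independent subfamily can be straightened by the inverse function
  theorem, and the remaining functions are constant along the resulting curve because their
  gradients stay in the span of the subfamily.  Hence the tangent cone is the linearized cone.
  Second, by a conic Caratheodory reduction, multipliers can be supported on families that are
  independent already at the reference point, so they can be bounded uniformly.  With Farkas' lemma
  this identifies the normal cone, and applied to the normal \<open>u - y\<close> at a projection \<open>y\<close> of \<open>u\<close> it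
  gives metric subregularity.  Third, differentiating a linear dependence between gradients along a
  constant rank family shows that \<open>\<nabla>\<^sup>2\<langle>\<lambda>, q\<rangle>(x) w\<close> depends on the multiplier
  only up to vectors orthogonal to the critical cone.  The two inclusions for the tangent cone to
  the graph then follow by passing to the limit in difference quotients of multipliers.
\<close>

subsection \<open>Normal cones, Farkas lemma and linearly independent families\<close>

text \<open>Gradients may be linearly dependent at the reference point, so a normal can have an
  unbounded set of multipliers and none of them is distinguished. This shapes two arguments. A limit
  of normals yields a multiplier only after bounded representatives have been chosen along the
  sequence, and the limiting multiplier cannot be prescribed; the upper estimate of the tangent cone
  to the graph therefore produces some multiplier, and replacing it by a given one is a separate
  step. In that step a dependence is differentiated without any differentiability of its
  coefficients relative to a basis: it is enough that they tend to zero, since they are only paired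
  with difference quotients of gradients. Uniformity in the point comes from the finite number of
  index families, each with its own lower bound.\<close>

lemma has_derivative_along_sequence:
  fixes f :: "'a::real_normed_vector \<Rightarrow> 'b::real_normed_vector"
  assumes f: "(f has_derivative f') (at x)"
    and t: "\<And>k. t k > 0" "t \<longlonglongrightarrow> 0" and u: "u \<longlonglongrightarrow> w"
  shows "(\<lambda>k. (f (x + t k *\<^sub>R u k) - f x) /\<^sub>R t k) \<longlonglongrightarrow> f' w"
proof -
  interpret f': bounded_linear f' using f by (rule has_derivative_bounded_linear)
  define r where "r h = (f (x + h) - f x - f' h) /\<^sub>R norm h" for h
  have "norm (r h) = norm (f (x + h) - f x - f' h) / norm h" for h
    by (simp add: r_def divide_inverse_commute)
  then have "(\<lambda>h. norm (r h)) \<midarrow>0\<rightarrow> 0"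
    using f unfolding has_derivative_at by presburger
  then have "r \<midarrow>0\<rightarrow> 0"
    unfolding tendsto_norm_zero_iff .
  \<comment> \<open>Division by zero gives 0, so \<open>r\<close> is continuous at 0; the increments
    \<open>t k *\<^sub>R u k\<close> may then vanish, which happens when
    \<open>u k = 0\<close>.\<close>
  moreover have r0: "r 0 = 0"
    by (simp add: r_def)
  ultimately have "isCont r 0"
    by (simp add: isCont_def)
  moreover have tu: "(\<lambda>k. t k *\<^sub>R u k) \<longlonglongrightarrow> 0"
    using tendsto_scaleR[OF t(2) u] by simp
  ultimately have "(\<lambda>k. r (t k *\<^sub>R u k)) \<longlonglongrightarrow> r 0"
    using isCont_tendsto_compose by blast
  then have "(\<lambda>k. r (t k *\<^sub>R u k)) \<longlonglongrightarrow> 0"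
    by (simp add: r0)
  then have "(\<lambda>k. f' (u k) + norm (u k) *\<^sub>R r (t k *\<^sub>R u k)) \<longlonglongrightarrow> f' w + norm w *\<^sub>R 0"
    by (intro tendsto_intros f'.tendsto u)
  moreover have "(f (x + t k *\<^sub>R u k) - f x) /\<^sub>R t k = f' (u k) + norm (u k) *\<^sub>R r (t k *\<^sub>R u k)" for k
  proof -
    have "f (x + t k *\<^sub>R u k) - f x = f' (t k *\<^sub>R u k) + norm (t k *\<^sub>R u k) *\<^sub>R r (t k *\<^sub>R u k)"
      by (cases "t k *\<^sub>R u k = 0") (simp_all add: r_def f'.zero del: norm_scaleR scaleR_eq_0_iff)
    then show ?thesis
      using t(1)[of k] by (simp add: f'.scaleR scaleR_right_distrib)
  qed
  ultimately show ?thesis by simp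
qed

lemma mem_regular_normal_cone_iff:
  "zs \<in> regular_normal_cone \<Omega> z \<longleftrightarrow>
    (\<forall>e>0. \<forall>\<^sub>F y in at z within \<Omega>. inner zs (y - z) \<le> e * norm (y - z))"
  (is "_ \<longleftrightarrow> ?R")
proof
  assume L: "zs \<in> regular_normal_cone \<Omega> z"
  show ?R
  proof (intro allI impI)
    fix e :: real assume "e > 0"
    then have "\<forall>\<^sub>F y in at z within \<Omega>. ereal (inner zs (y - z) / norm (y - z)) < ereal e"
      using L unfolding regular_normal_cone_def Limsup_le_iff mem_Collect_eq
      by (meson ereal_less(2))
    moreover have "\<forall>\<^sub>F y in at z within \<Omega>. y \<noteq> z"
      by (auto simp: eventually_at_filter)
    ultimately show "\<forall>\<^sub>F y in at z within \<Omega>. inner zs (y - z) \<le> e * norm (y - z)"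
      by eventually_elim (simp add: divide_simps)
  qed
next
  assume R: ?R
  show "zs \<in> regular_normal_cone \<Omega> z"
    unfolding regular_normal_cone_def mem_Collect_eq Limsup_le_iff
  proof (intro allI impI)
    fix y :: ereal assume "y > 0"
    then obtain e where e: "e > 0" "ereal e < y"
      using ereal_dense2[of 0 y] by (auto simp: zero_ereal_def)
    have "\<forall>\<^sub>F y in at z within \<Omega>. inner zs (y - z) \<le> e * norm (y - z)"
      using R e by blast
    moreover have "\<forall>\<^sub>F y in at z within \<Omega>. y \<noteq> z"
      by (auto simp: eventually_at_filter)
    ultimately show "\<forall>\<^sub>F x in at z within \<Omega>. ereal (inner zs (x - z) / norm (x - z)) < y"
    proof eventually_elim
      case (elim x)
      then have "inner zs (x - z) / norm (x - z) \<le> e"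
        by (simp add: divide_simps)
      then show ?case
        using e(2) by (meson ereal_less_eq(3) le_less_trans)
    qed
  qed
qed

lemma regular_normal_tangent_le:
  assumes zs: "zs \<in> regular_normal_cone \<Omega> z" and u: "u \<in> tangent_cone \<Omega> z"
  shows "inner zs u \<le> 0"
proof (rule field_le_epsilon)
  fix \<epsilon> :: real assume "\<epsilon> > 0"
  define e where "e = \<epsilon> / (norm u + 1)"
  have e: "e > 0" using \<open>\<epsilon> > 0\<close> by (simp add: e_def add_nonneg_pos)
  obtain t uu where t: "\<And>k. t k > (0::real)" "t \<longlonglongrightarrow> 0" and uu: "uu \<longlonglongrightarrow> u"
    and mem: "\<And>k. z + t k *\<^sub>R uu k \<in> \<Omega>"
    using u unfolding tangent_cone_def by auto
  have "\<forall>\<^sub>F y in at z within \<Omega>. inner zs (y - z) \<le> e * norm (y - z)"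
    using zs e unfolding mem_regular_normal_cone_iff by blast
  \<comment> \<open>The points \<open>z + t k *\<^sub>R uu k\<close> may coincide with
    \<open>z\<close>; both sides vanish there, so the punctured filter can be replaced by
    \<open>nhds z\<close>.\<close>
  then have "\<forall>\<^sub>F y in nhds z. y \<in> \<Omega> \<longrightarrow> inner zs (y - z) \<le> e * norm (y - z)"
    unfolding eventually_at_filter by eventually_elim auto
  moreover have "(\<lambda>k. z + t k *\<^sub>R uu k) \<longlonglongrightarrow> z + 0 *\<^sub>R u"
    by (intro tendsto_intros t uu)
  ultimately have "\<forall>\<^sub>F k in sequentially. inner zs (t k *\<^sub>R uu k) \<le> e * norm (t k *\<^sub>R uu k)"
    using mem by (auto simp: filterlim_iff elim!: allE eventually_mono)
  then have "\<forall>\<^sub>F k in sequentially. inner zs (uu k) \<le> e * norm (uu k)"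
  proof eventually_elim
    case (elim k)
    then have "t k * inner zs (uu k) \<le> t k * (e * norm (uu k))"
      using t(1)[of k] by (simp add: algebra_simps)
    then show ?case using t(1)[of k] by simp
  qed
  then have "inner zs u \<le> e * norm u"
    by (intro tendsto_le[OF _ _ tendsto_inner[OF tendsto_const uu]])
       (auto intro!: tendsto_intros uu)
  also have "\<dots> \<le> \<epsilon>"
    using \<open>\<epsilon> > 0\<close> by (simp add: e_def divide_simps add_nonneg_pos mult_left_mono)
  finally show "inner zs u \<le> 0 + \<epsilon>" by simp
qed

text \<open>A segment inside \<open>K\<close> makes \<open>u - zk\<close> tangent at
  \<open>zk\<close>, so a regular normal at \<open>zk\<close> satisfies the global inequality
  \<open>inner n (u - zk) \<le> 0\<close>, which survives limits. The limiting cone thus coincides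
  with that of convex analysis, and is empty for \<open>w\<close> outside \<open>K\<close>.\<close>

lemma normal_cone_convex_cone:
  assumes K: "convex_cone K"
  shows "normal_cone K w = {n. w \<in> K \<and> inner n w = 0 \<and> (\<forall>u\<in>K. inner n u \<le> 0)}"
proof (intro equalityI subsetI)
  fix n assume "n \<in> normal_cone K w"
  then obtain zk nk where w: "w \<in> K" and zk: "\<And>k. zk k \<in> K" "zk \<longlonglongrightarrow> w"
    and nk: "\<And>k. nk k \<in> regular_normal_cone K (zk k)" "nk \<longlonglongrightarrow> n"
    unfolding normal_cone_def by auto
  have le: "inner n (u - w) \<le> 0" if u: "u \<in> K" for u
  proof -
    have "inner (nk k) (u - zk k) \<le> 0" for k
    proof (rule regular_normal_tangent_le[OF nk(1)])
      have "zk k + inverse (real (Suc j)) *\<^sub>R (u - zk k) \<in> K" for j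
      proof -
        have "(1 - inverse (real (Suc j))) *\<^sub>R zk k + inverse (real (Suc j)) *\<^sub>R u \<in> K"
          using K zk(1) u by (intro convexD) (auto simp: convex_cone_def divide_simps)
        then show ?thesis by (simp add: algebra_simps)
      qed
      then show "u - zk k \<in> tangent_cone K (zk k)"
        unfolding tangent_cone_def mem_Collect_eq
        by (intro exI[of _ "\<lambda>j. inverse (real (Suc j))"] exI[of _ "\<lambda>j. u - zk k"])
           (use LIMSEQ_inverse_real_of_nat in auto)
    qed
    then show ?thesis
      by (intro LIMSEQ_le_const2[of "\<lambda>k. inner (nk k) (u - zk k)"] tendsto_intros zk nk) auto
  qed
  have "2 *\<^sub>R w \<in> K" "0 \<in> K"
    using w K by (auto simp: convex_cone_iff)
  from le[OF this(1)] le[OF this(2)] have "inner n w = 0"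
    by (simp add: algebra_simps)
  with le w show "n \<in> {n. w \<in> K \<and> inner n w = 0 \<and> (\<forall>u\<in>K. inner n u \<le> 0)}"
    by (auto simp: inner_diff_right)
next
  fix n assume n: "n \<in> {n. w \<in> K \<and> inner n w = 0 \<and> (\<forall>u\<in>K. inner n u \<le> 0)}"
  have "n \<in> regular_normal_cone K w"
    unfolding mem_regular_normal_cone_iff eventually_at_filter
  proof (intro allI impI always_eventually)
    fix e :: real and y assume "e > 0" "y \<in> K"
    then have "inner n (y - w) \<le> 0" "0 \<le> e * norm (y - w)"
      using n by (auto simp: inner_diff_right)
    then show "inner n (y - w) \<le> e * norm (y - w)" by linarith
  qed
  then show "n \<in> normal_cone K w"
    unfolding normal_cone_def mem_Collect_eq using n
    by (intro conjI exI[of _ "\<lambda>k. w"] exI[of _ "\<lambda>k. n"]) auto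
qed

text \<open>A finitely generated cone is closed, so a vector outside it can be strictly separated.
  Sign-free coefficients on \<open>P\<close> arise by taking both \<open>a i\<close> and
  \<open>- a i\<close> as generators; \<open>disj\<close> keeps the coefficient -1 from violating
  the sign condition on \<open>N\<close>.\<close>

lemma farkas:
  fixes a :: "'m::finite \<Rightarrow> 'a::euclidean_space"
  assumes disj: "P \<inter> N = {}"
    and le: "\<And>u. \<lbrakk>\<And>i. i \<in> P \<Longrightarrow> inner (a i) u = 0; \<And>i. i \<in> N \<Longrightarrow> inner (a i) u \<le> 0\<rbrakk>
               \<Longrightarrow> inner n u \<le> 0"
  obtains \<nu> :: "real^'m" where "n = (\<Sum>i\<in>UNIV. \<nu> $ i *\<^sub>R a i)"
    "\<forall>i. i \<notin> P \<union> N \<longrightarrow> \<nu> $ i = 0" "\<forall>i\<in>N. \<nu> $ i \<ge> 0"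
proof -
  define F :: "(real^'m) set" where
    "F = {\<nu>. (\<forall>i. i \<notin> P \<union> N \<longrightarrow> \<nu> $ i = 0) \<and> (\<forall>i\<in>N. \<nu> $ i \<ge> 0)}"
  define L :: "real^'m \<Rightarrow> 'a" where "L \<nu> = (\<Sum>i\<in>UNIV. \<nu> $ i *\<^sub>R a i)" for \<nu>
  define S where "S = a ` (P \<union> N) \<union> (\<lambda>i. - a i) ` P"
  have linL: "linear L"
    by (auto intro!: linearI simp: L_def algebra_simps sum.distrib scaleR_sum_right)
  have "convex_cone F"
    by (auto simp: convex_cone_iff F_def)
  then have "convex_cone (L ` F)"
    using linL by (simp add: convex_cone_linear_image)
  moreover have "S \<subseteq> L ` F"
  proof
    fix s assume "s \<in> S"
    then consider i where "i \<in> P \<union> N" "s = a i" | i where "i \<in> P" "s = - a i"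
      by (auto simp: S_def)
    then show "s \<in> L ` F"
    proof cases
      case 1
      then show ?thesis
        by (intro image_eqI[of _ _ "axis i 1"])
           (auto simp: L_def F_def axis_def if_distrib[of "\<lambda>c. c *\<^sub>R _"] cong: if_cong)
    next
      case 2
      then show ?thesis
        using disj by (intro image_eqI[of _ _ "axis i (-1)"])
           (auto simp: L_def F_def axis_def if_distrib[of "\<lambda>c. c *\<^sub>R _"] cong: if_cong)
    qed
  qed
  ultimately have hull: "convex_cone hull S \<subseteq> L ` F"
    by (simp add: hull_minimal)
  have "n \<in> convex_cone hull S"
  proof (rule ccontr)
    assume "n \<notin> convex_cone hull S"
    moreover have "closed (convex_cone hull S)"
      by (rule closed_convex_cone_hull) (simp add: S_def)
    ultimately obtain c b where cb: "inner c n < b" "\<And>s. s \<in> convex_cone hull S \<Longrightarrow> inner c s > b"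
      using separating_hyperplane_closed_point[OF convex_convex_cone_hull[of S], of n] by auto
    have "b < 0"
      using cb(2)[OF convex_cone_hull_contains_0] by simp
    \<comment> \<open>If \<open>inner c s\<close> were negative, a positive multiple of
      \<open>s\<close> would lie exactly on the hyperplane at level \<open>b\<close>, against strict
      separation.\<close>
    have nonneg: "inner c s \<ge> 0" if "s \<in> S" for s
    proof (rule ccontr)
      assume neg: "\<not> inner c s \<ge> 0"
      then have "(b / inner c s) *\<^sub>R s \<in> convex_cone hull S"
        using that \<open>b < 0\<close> by (intro convex_cone_hull_mul hull_inc) (auto simp: divide_simps)
      from cb(2)[OF this] show False using neg by simp
    qed
    have "inner n (- c) \<le> 0"
    proof (rule le)
      fix i assume i: "i \<in> P"
      then have "inner c (a i) \<ge> 0" "inner c (- a i) \<ge> 0"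
        by (auto intro!: nonneg simp: S_def simp del: inner_minus_right)
      then show "inner (a i) (- c) = 0"
        by (simp add: inner_commute)
    next
      fix i assume "i \<in> N"
      then show "inner (a i) (- c) \<le> 0"
        using nonneg[of "a i"] by (simp add: S_def inner_commute)
    qed
    then show False
      using cb(1) \<open>b < 0\<close> by (simp add: inner_commute)
  qed
  with hull obtain \<nu> where "\<nu> \<in> F" "n = L \<nu>" by auto
  then show thesis
    using that[of \<nu>] by (auto simp: F_def L_def)
qed

text \<open>Indices rather than vectors are counted: a repeated vector makes the family dependent,
  so the number of indices can be compared with the rank.\<close>

definition lin_indep :: "('m \<Rightarrow> 'a::real_vector) \<Rightarrow> 'm set \<Rightarrow> bool" where
  "lin_indep a B \<longleftrightarrow> (\<forall>c. (\<Sum>i\<in>B. c i *\<^sub>R a i) = 0 \<longrightarrow> (\<forall>i\<in>B. c i = 0))"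

lemma lin_indep_iff:
  assumes "finite B"
  shows "lin_indep a B \<longleftrightarrow> inj_on a B \<and> independent (a ` B)"
proof
  assume L: "lin_indep a B"
  have inj: "inj_on a B"
  proof (rule inj_onI, rule ccontr)
    fix i j assume ij: "i \<in> B" "j \<in> B" "a i = a j" "i \<noteq> j"
    define c where "c k = (if k = i then 1 else if k = j then -1 else (0::real))" for k
    have "(\<Sum>k\<in>B. c k *\<^sub>R a k) = (\<Sum>k\<in>{i, j}. c k *\<^sub>R a k)"
      using ij assms by (intro sum.mono_neutral_right) (auto simp: c_def)
    also have "\<dots> = 0"
      using ij by (simp add: c_def)
    finally have "c i = 0"
      using L ij unfolding lin_indep_def by blast
    then show False by (simp add: c_def)
  qed
  moreover have "independent (a ` B)"
  proof (subst independent_explicit_finite_subsets, intro allI impI ballI)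
    fix S u v assume S: "S \<subseteq> a ` B" "finite S" "(\<Sum>v\<in>S. u v *\<^sub>R v) = 0" "v \<in> S"
    define c where "c i = (if a i \<in> S then u (a i) else 0)" for i
    have "(\<Sum>i\<in>B. c i *\<^sub>R a i) = (\<Sum>v\<in>a ` B. (if v \<in> S then u v else 0) *\<^sub>R v)"
      by (simp add: sum.reindex[OF inj] c_def)
    also have "\<dots> = (\<Sum>v\<in>S. u v *\<^sub>R v)"
      using S assms by (intro sum.mono_neutral_cong_right) auto
    finally have "\<forall>i\<in>B. c i = 0"
      using L S unfolding lin_indep_def by metis
    moreover obtain i where "i \<in> B" "v = a i"
      using S by blast
    ultimately show "u v = 0"
      using S by (metis c_def)
  qed
  ultimately show "inj_on a B \<and> independent (a ` B)" by blast
next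
  assume R: "inj_on a B \<and> independent (a ` B)"
  show "lin_indep a B"
    unfolding lin_indep_def
  proof (intro allI impI ballI)
    fix c i assume c: "(\<Sum>i\<in>B. c i *\<^sub>R a i) = 0" and i: "i \<in> B"
    have "(\<Sum>v\<in>a ` B. c (the_inv_into B a v) *\<^sub>R v) = (\<Sum>i\<in>B. c i *\<^sub>R a i)"
      using R by (simp add: sum.reindex the_inv_into_f_f)
    then have "c (the_inv_into B a (a i)) = 0"
      using R c i independentD[of "a ` B" "a ` B" "\<lambda>v. c (the_inv_into B a v)" "a i"] assms
      by auto
    then show "c i = 0"
      using R i by (simp add: the_inv_into_f_f)
  qed
qed

text \<open>Rank is what the constraint qualification controls, independence is what coefficient
  bounds need. This equivalence lets independence be carried from one point to another.\<close>

lemma lin_indep_iff_dim: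
  fixes a :: "'m \<Rightarrow> 'a::euclidean_space"
  assumes "finite B"
  shows "lin_indep a B \<longleftrightarrow> dim (a ` B) = card B"
proof
  assume "lin_indep a B"
  then show "dim (a ` B) = card B"
    using assms by (simp add: lin_indep_iff dim_eq_card_independent card_image)
next
  assume d: "dim (a ` B) = card B"
  have "card B \<le> card (a ` B)"
    using d dim_le_card'[of "a ` B"] assms by simp
  then have "card (a ` B) = card B"
    using card_image_le[OF assms, of a] by simp
  then show "lin_indep a B"
    using d assms by (simp add: lin_indep_iff eq_card_imp_inj_on card_le_dim_spanning[of "a ` B" "a ` B"] span_superset)
qed

lemma lin_indep_basis_exists:
  fixes a :: "'m \<Rightarrow> 'a::euclidean_space"
  assumes "finite A"
  obtains B where "B \<subseteq> A" "lin_indep a B" "span (a ` B) = span (a ` A)"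
proof -
  obtain S where S: "S \<subseteq> a ` A" "independent S" "a ` A \<subseteq> span S"
    using maximal_independent_subset by blast
  obtain B where B: "B \<subseteq> A" "inj_on a B" "S = a ` B"
    using S(1) by (meson subset_image_inj)
  have "span (a ` B) = span (a ` A)"
    using S B by (metis image_mono span_minimal span_mono subspace_span subset_antisym)
  moreover have "lin_indep a B"
    using assms B S by (simp add: lin_indep_iff finite_subset)
  ultimately show thesis using that B by blast
qed

lemma span_image_coeffs:
  fixes a :: "'m::finite \<Rightarrow> 'a::real_vector"
  assumes "v \<in> span (a ` B)"
  obtains c :: "real^'m" where "\<And>i. i \<notin> B \<Longrightarrow> c $ i = 0" "v = (\<Sum>i\<in>UNIV. c $ i *\<^sub>R a i)"
proof -
  define L :: "real^'m \<Rightarrow> 'a" where "L c = (\<Sum>i\<in>UNIV. c $ i *\<^sub>R a i)" for c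
  define F :: "(real^'m) set" where "F = {c. \<forall>i. i \<notin> B \<longrightarrow> c $ i = 0}"
  have "linear L"
    by (auto intro!: linearI simp: L_def algebra_simps sum.distrib scaleR_sum_right)
  then have "subspace (L ` F)"
    by (rule linear_subspace_image) (auto simp: F_def subspace_def)
  moreover have "a ` B \<subseteq> L ` F"
  proof
    fix s assume "s \<in> a ` B"
    then obtain i where "i \<in> B" "s = a i" by auto
    then show "s \<in> L ` F"
      by (intro image_eqI[of _ _ "axis i 1"])
         (auto simp: L_def F_def axis_def if_distrib[of "\<lambda>c. c *\<^sub>R _"] cong: if_cong)
  qed
  ultimately have "v \<in> L ` F"
    using assms span_minimal by blast
  then show thesis using that by (auto simp: L_def F_def)
qed

text \<open>At \<open>x\<close> the combination map is injective on a coordinate subspace, hence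
  bounded below by some \<open>e\<close> in finite dimension. Moving the vectors by less than
  \<open>e/2\<close> in total lowers the bound by at most \<open>e/2\<close>, so one constant serves
  all nearby points.\<close>

lemma lin_indep_bounded_below:
  fixes g :: "'m::finite \<Rightarrow> 'a::t2_space \<Rightarrow> 'b::euclidean_space"
  assumes ind: "lin_indep (\<lambda>i. g i x) B" and cont: "\<And>i. isCont (g i) x"
  obtains \<kappa> where "\<kappa> > 0"
    "\<forall>\<^sub>F y in nhds x. \<forall>c::real^'m. (\<forall>i. i \<notin> B \<longrightarrow> c $ i = 0) \<longrightarrow>
        \<kappa> * norm c \<le> norm (\<Sum>i\<in>UNIV. c $ i *\<^sub>R g i y)"
proof -
  define L :: "'a \<Rightarrow> real^'m \<Rightarrow> 'b" where "L y c = (\<Sum>i\<in>UNIV. c $ i *\<^sub>R g i y)" for y c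
  define F :: "(real^'m) set" where "F = {c. \<forall>i. i \<notin> B \<longrightarrow> c $ i = 0}"
  have "linear (L x)"
    by (auto intro!: linearI simp: L_def algebra_simps sum.distrib scaleR_sum_right)
  then have "bounded_linear (L x)" by (rule linear_conv_bounded_linear[THEN iffD1])
  moreover have sub: "subspace F" by (auto simp: F_def subspace_def)
  moreover have "c = 0" if "c \<in> F" "L x c = 0" for c
  proof -
    have "L x c = (\<Sum>i\<in>B. c $ i *\<^sub>R g i x)"
      unfolding L_def using that by (intro sum.mono_neutral_right) (auto simp: F_def)
    then have "\<forall>i\<in>B. c $ i = 0"
      using ind that unfolding lin_indep_def by metis
    then show "c = 0"
      using that by (auto simp: vec_eq_iff F_def)
  qed
  ultimately obtain e where e: "e > 0" "\<And>c. c \<in> F \<Longrightarrow> e * norm c \<le> norm (L x c)"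
    using injective_imp_isometric[OF closed_subspace[OF sub] sub] by blast
  have "(\<lambda>y. \<Sum>i\<in>UNIV. norm (g i y - g i x)) \<midarrow>x\<rightarrow> (\<Sum>i\<in>UNIV. norm (g i x - g i x))"
    using cont by (intro tendsto_intros) (auto simp: isCont_def)
  then have "((\<lambda>y. \<Sum>i\<in>UNIV. norm (g i y - g i x)) \<longlongrightarrow> 0) (nhds x)"
    by (simp add: tendsto_nhds_iff)
  then have "\<forall>\<^sub>F y in nhds x. (\<Sum>i\<in>UNIV. norm (g i y - g i x)) < e / 2"
    using e by (intro order_tendstoD(2)) auto
  then have "\<forall>\<^sub>F y in nhds x. \<forall>c. c \<in> F \<longrightarrow> (e/2) * norm c \<le> norm (L y c)"
  proof eventually_elim
    case (elim y)
    show ?case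
    proof (intro allI impI)
      fix c assume c: "c \<in> F"
      have "norm (L y c - L x c) = norm (\<Sum>i\<in>UNIV. c $ i *\<^sub>R (g i y - g i x))"
        by (simp add: L_def sum_subtractf scaleR_diff_right)
      also have "\<dots> \<le> (\<Sum>i\<in>UNIV. norm c * norm (g i y - g i x))"
        by (intro order_trans[OF norm_sum] sum_mono)
           (simp add: mult_right_mono component_le_norm_cart)
      also have "\<dots> = norm c * (\<Sum>i\<in>UNIV. norm (g i y - g i x))"
        by (simp add: sum_distrib_left)
      also have "\<dots> \<le> norm c * (e / 2)"
        using elim by (intro mult_left_mono) auto
      finally have "norm (L y c - L x c) \<le> norm c * (e / 2)" .
      then show "(e/2) * norm c \<le> norm (L y c)"
        using e(2)[OF c] norm_triangle_ineq2[of "L x c" "L y c"]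
        by (simp add: norm_minus_commute algebra_simps)
    qed
  qed
  then show thesis
    using that[of "e/2"] e by (simp add: F_def L_def)
qed

subsection \<open>Families of constant rank\<close>

text \<open>A basis of the family at \<open>x\<close> stays independent nearby by the lower bound.
  As the rank of the whole family does not change, the subfamily has enough elements to span it at
  every nearby point as well.\<close>

lemma constant_rank_basis:
  fixes g :: "'m::finite \<Rightarrow> 'a::t2_space \<Rightarrow> 'b::euclidean_space"
  assumes "open V" "x \<in> V"
    and rank: "\<And>y. y \<in> V \<Longrightarrow> dim ((\<lambda>i. g i y) ` A) = dim ((\<lambda>i. g i x) ` A)"
    and cont: "\<And>i. isCont (g i) x"
  obtains B \<kappa> where "B \<subseteq> A" "lin_indep (\<lambda>i. g i x) B" "\<kappa> > 0"
    "\<forall>\<^sub>F y in nhds x. span ((\<lambda>i. g i y) ` B) = span ((\<lambda>i. g i y) ` A) \<and>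
       (\<forall>c::real^'m. (\<forall>i. i \<notin> B \<longrightarrow> c $ i = 0) \<longrightarrow>
          \<kappa> * norm c \<le> norm (\<Sum>i\<in>UNIV. c $ i *\<^sub>R g i y))"
proof -
  obtain B where B: "B \<subseteq> A" "lin_indep (\<lambda>i. g i x) B" "span ((\<lambda>i. g i x) ` B) = span ((\<lambda>i. g i x) ` A)"
    using lin_indep_basis_exists[of A "\<lambda>i. g i x"] by auto
  obtain \<kappa> where \<kappa>: "\<kappa> > 0" and ev: "\<forall>\<^sub>F y in nhds x. \<forall>c::real^'m. (\<forall>i. i \<notin> B \<longrightarrow> c $ i = 0) \<longrightarrow>
        \<kappa> * norm c \<le> norm (\<Sum>i\<in>UNIV. c $ i *\<^sub>R g i y)"
    using lin_indep_bounded_below[of g x B, OF B(2) cont] by blast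
  have "\<forall>\<^sub>F y in nhds x. y \<in> V"
    using assms(1,2) by (rule eventually_nhds_in_open)
  with ev have "\<forall>\<^sub>F y in nhds x. span ((\<lambda>i. g i y) ` B) = span ((\<lambda>i. g i y) ` A) \<and>
       (\<forall>c::real^'m. (\<forall>i. i \<notin> B \<longrightarrow> c $ i = 0) \<longrightarrow>
          \<kappa> * norm c \<le> norm (\<Sum>i\<in>UNIV. c $ i *\<^sub>R g i y))"
  proof eventually_elim
    case (elim y)
    have "lin_indep (\<lambda>i. g i y) B"
      unfolding lin_indep_def
    proof (intro allI impI ballI)
      fix c i assume c: "(\<Sum>i\<in>B. c i *\<^sub>R g i y) = 0" and i: "i \<in> B"
      define C :: "real^'m" where "C = (\<chi> i. if i \<in> B then c i else 0)"
      have "(\<Sum>i\<in>UNIV. C $ i *\<^sub>R g i y) = (\<Sum>i\<in>B. c i *\<^sub>R g i y)"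
        by (intro sum.mono_neutral_cong_right) (auto simp: C_def)
      moreover have "\<kappa> * norm C \<le> norm (\<Sum>i\<in>UNIV. C $ i *\<^sub>R g i y)"
        using elim(1)[rule_format, of C] by (simp add: C_def)
      ultimately have "\<kappa> * norm C \<le> 0"
        using c by simp
      then have "C = 0"
        using \<kappa> by (simp add: mult_le_0_iff)
      then have "C $ i = 0" by simp
      then show "c i = 0" using i by (simp add: C_def)
    qed
    then have "dim ((\<lambda>i. g i y) ` B) = dim ((\<lambda>i. g i x) ` B)"
      using B(2) by (simp add: lin_indep_iff_dim)
    also have "\<dots> = dim ((\<lambda>i. g i y) ` A)"
      using B(3) rank[OF elim(2)] by (metis dim_span)
    finally have "span ((\<lambda>i. g i y) ` B) = span ((\<lambda>i. g i y) ` A)"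
      using B(1) by (intro dim_eq_span) (auto simp: image_mono)
    with elim show ?case by blast
  qed
  with B \<kappa> that show thesis by blast
qed

text \<open>A dependence at \<open>x\<close> need not persist, but its defect \<open>S y\<close> can
  be written in the basis \<open>B\<close> with coefficients bounded by
  \<open>norm (S y) / \<kappa>\<close>, hence tending to zero. Pairing the difference quotient of
  \<open>S\<close> with \<open>u\<close>, which is orthogonal to the family at \<open>x\<close>,
  leaves vanishing coefficients times convergent difference quotients.\<close>

lemma constant_rank_derivative_dependence:
  fixes g :: "'m::finite \<Rightarrow> 'a::real_normed_vector \<Rightarrow> 'b::euclidean_space"
  assumes V: "open V" "x \<in> V"
    and rank: "\<And>y. y \<in> V \<Longrightarrow> dim ((\<lambda>i. g i y) ` A) = dim ((\<lambda>i. g i x) ` A)"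
    and g: "\<And>i. (g i has_derivative g' i) (at x)"
    and \<delta>: "\<And>i. i \<notin> A \<Longrightarrow> \<delta> $ i = 0" "(\<Sum>i\<in>UNIV. \<delta> $ i *\<^sub>R g i x) = 0"
    and u: "\<And>i. i \<in> A \<Longrightarrow> inner (g i x) u = 0"
  shows "inner (\<Sum>i\<in>UNIV. \<delta> $ i *\<^sub>R g' i w) u = 0"
proof -
  have cont: "isCont (g i) x" for i
    using g by (rule has_derivative_continuous)
  obtain B \<kappa> where B: "B \<subseteq> A" "lin_indep (\<lambda>i. g i x) B" and \<kappa>: "\<kappa> > 0"
    and ev: "\<forall>\<^sub>F y in nhds x. span ((\<lambda>i. g i y) ` B) = span ((\<lambda>i. g i y) ` A) \<and>
       (\<forall>c::real^'m. (\<forall>i. i \<notin> B \<longrightarrow> c $ i = 0) \<longrightarrow>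
          \<kappa> * norm c \<le> norm (\<Sum>i\<in>UNIV. c $ i *\<^sub>R g i y))"
    by (rule constant_rank_basis[of V x g A, OF V rank cont])
  define S where "S y = (\<Sum>i\<in>UNIV. \<delta> $ i *\<^sub>R g i y)" for y
  have "\<forall>\<^sub>F y in nhds x. \<exists>c::real^'m. (\<forall>i. i \<notin> B \<longrightarrow> c $ i = 0) \<and> S y = (\<Sum>i\<in>UNIV. c $ i *\<^sub>R g i y)
      \<and> \<kappa> * norm c \<le> norm (S y)"
    using ev
  proof eventually_elim
    case (elim y)
    have "S y = (\<Sum>i\<in>A. \<delta> $ i *\<^sub>R g i y)"
      unfolding S_def using \<delta>(1) by (intro sum.mono_neutral_right) auto
    also have "\<dots> \<in> span ((\<lambda>i. g i y) ` A)"
      by (intro span_sum span_scale span_base) auto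
    finally have "S y \<in> span ((\<lambda>i. g i y) ` B)"
      using elim by blast
    then obtain c :: "real^'m" where "\<And>i. i \<notin> B \<Longrightarrow> c $ i = 0" "S y = (\<Sum>i\<in>UNIV. c $ i *\<^sub>R g i y)"
      using span_image_coeffs[of "S y" "\<lambda>i. g i y" B] by blast
    with elim show ?case by metis
  qed
  then obtain c :: "'a \<Rightarrow> real^'m" where
    c: "\<forall>\<^sub>F y in nhds x. (\<forall>i. i \<notin> B \<longrightarrow> c y $ i = 0) \<and> S y = (\<Sum>i\<in>UNIV. c y $ i *\<^sub>R g i y)
      \<and> \<kappa> * norm (c y) \<le> norm (S y)"
    by (rule eventually_ex[THEN iffD1, THEN exE])
  define t where "t k = inverse (real (Suc k))" for k
  have t: "\<And>k. t k > 0" "t \<longlonglongrightarrow> 0"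
    using LIMSEQ_inverse_real_of_nat unfolding t_def by auto
  define y where "y k = x + t k *\<^sub>R w" for k
  have "y \<longlonglongrightarrow> x + 0 *\<^sub>R w"
    unfolding y_def by (intro tendsto_intros t)
  then have y: "y \<longlonglongrightarrow> x" by simp
  have cy: "\<forall>\<^sub>F k in sequentially. (\<forall>i. i \<notin> B \<longrightarrow> c (y k) $ i = 0) \<and>
      S (y k) = (\<Sum>i\<in>UNIV. c (y k) $ i *\<^sub>R g i (y k)) \<and> \<kappa> * norm (c (y k)) \<le> norm (S (y k))"
    using y c by (auto simp: filterlim_iff)
  define D where "D i k = (g i (y k) - g i x) /\<^sub>R t k" for i k
  have D: "D i \<longlonglongrightarrow> g' i w" for i
    unfolding D_def y_def by (rule has_derivative_along_sequence[OF g t tendsto_const])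
  have "(\<lambda>k. S (y k)) \<longlonglongrightarrow> S x"
    unfolding S_def by (intro tendsto_intros isCont_tendsto_compose[OF cont y])
  from tendsto_divide[OF tendsto_norm[OF this] tendsto_const[of \<kappa>]]
  have "(\<lambda>k. norm (S (y k)) / \<kappa>) \<longlonglongrightarrow> 0"
    using \<kappa> \<delta>(2) by (simp add: S_def[of x])
  then have c0: "(\<lambda>k. c (y k)) \<longlonglongrightarrow> 0"
  proof (rule Lim_null_comparison[rotated])
    show "\<forall>\<^sub>F k in sequentially. norm (c (y k)) \<le> norm (S (y k)) / \<kappa>"
      using cy by eventually_elim (use \<kappa> in \<open>auto simp: field_simps\<close>)
  qed
  have "(\<lambda>k. \<Sum>i\<in>UNIV. c (y k) $ i * inner (D i k) u) \<longlonglongrightarrow> (\<Sum>i\<in>UNIV. 0 $ i * inner (g' i w) u)"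
    by (intro tendsto_intros D c0)
  moreover have "\<forall>\<^sub>F k in sequentially. (\<Sum>i\<in>UNIV. c (y k) $ i * inner (D i k) u) =
      inner (\<Sum>i\<in>UNIV. \<delta> $ i *\<^sub>R D i k) u"
    using cy
  proof eventually_elim
    case (elim k)
    \<comment> \<open>On \<open>B\<close> the value \<open>inner (g i x) u\<close> vanishes, so
      inside the pairing \<open>D i k\<close> may be replaced by
      \<open>g i (y k) /\<^sub>R t k\<close>; off \<open>B\<close> the coefficient is zero.\<close>
    have "(\<Sum>i\<in>UNIV. c (y k) $ i * inner (D i k) u) = (\<Sum>i\<in>UNIV. inverse (t k) * (c (y k) $ i * inner (g i (y k)) u))"
    proof (rule sum.cong[OF refl])
      fix i show "c (y k) $ i * inner (D i k) u = inverse (t k) * (c (y k) $ i * inner (g i (y k)) u)"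
        using elim u[of i] B by (cases "i \<in> B") (auto simp: D_def inner_diff_left)
    qed
    also have "\<dots> = inverse (t k) * inner (S (y k)) u"
      by (subst elim[THEN conjunct2, THEN conjunct1]) (simp add: inner_sum_left sum_distrib_left)
    also have "S (y k) = S (y k) - S x"
      using \<delta>(2) by (simp add: S_def)
    also have "inverse (t k) * inner (S (y k) - S x) u = inner (\<Sum>i\<in>UNIV. \<delta> $ i *\<^sub>R D i k) u"
      by (simp add: S_def D_def sum_subtractf[symmetric] inner_sum_left sum_distrib_left inner_diff_left)
        (simp add: algebra_simps)
    finally show ?case .
  qed
  ultimately have "(\<lambda>k. inner (\<Sum>i\<in>UNIV. \<delta> $ i *\<^sub>R D i k) u) \<longlonglongrightarrow> 0"
    by (auto elim: Lim_transform_eventually)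
  moreover have "(\<lambda>k. inner (\<Sum>i\<in>UNIV. \<delta> $ i *\<^sub>R D i k) u) \<longlonglongrightarrow> inner (\<Sum>i\<in>UNIV. \<delta> $ i *\<^sub>R g' i w) u"
    by (intro tendsto_intros D)
  ultimately show ?thesis
    using LIMSEQ_unique by blast
qed

lemma lin_indep_dual:
  fixes a :: "'m \<Rightarrow> 'a::euclidean_space"
  assumes "finite B" "lin_indep a B"
  obtains d where "\<And>i j. i \<in> B \<Longrightarrow> j \<in> B \<Longrightarrow> inner (a i) (d j) = (if i = j then 1 else 0)"
proof -
  have ind: "inj_on a B" "independent (a ` B)"
    using assms by (auto simp: lin_indep_iff)
  have "\<exists>d. \<forall>i\<in>B. inner (a i) d = (if i = j then 1 else 0)" if "j \<in> B" for j
  proof -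
    obtain f :: "'a \<Rightarrow> real" where f: "linear f" "\<And>v. v \<in> a ` B \<Longrightarrow> f v = (if v = a j then 1 else 0)"
      using linear_independent_extend[OF ind(2), of "\<lambda>v. if v = a j then 1 else 0"] by auto
    have "inner (a i) (adjoint f 1) = (if i = j then 1 else 0)" if "i \<in> B" for i
      using f that \<open>j \<in> B\<close> ind(1) by (auto simp: adjoint_works inj_on_eq_iff)
    then show ?thesis by blast
  qed
  then show thesis using that by metis
qed

text \<open>Only the functions in \<open>B\<close> can be prescribed by the inverse function
  theorem. For the others a derivative is computed at every point of the curve, so the equality of
  spans must hold along the whole curve and not only at \<open>x\<close>; the radius
  \<open>e\<close> secures this.\<close>

lemma constant_rank_tangent:
  fixes q :: "'m::finite \<Rightarrow> 'a::euclidean_space \<Rightarrow> real"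
  assumes V: "open V" "x \<in> V"
    and rank: "\<And>y. y \<in> V \<Longrightarrow> dim ((\<lambda>i. g i y) ` A) = dim ((\<lambda>i. g i x) ` A)"
    and q: "\<And>i y. (q i has_derivative (\<lambda>h. inner (g i y) h)) (at y)"
    and g: "\<And>i. continuous_on UNIV (g i)"
    and w: "\<And>i. i \<in> A \<Longrightarrow> inner (g i x) w = 0"
  obtains t u where "\<And>k. t k > (0::real)" "t \<longlonglongrightarrow> 0" "u \<longlonglongrightarrow> w"
    "\<And>i k. i \<in> A \<Longrightarrow> q i (x + t k *\<^sub>R u k) = q i x"
proof -
  have cont: "isCont (g i) y" for i y
    using g by (simp add: continuous_on_eq_continuous_at)
  obtain B \<kappa> where B: "B \<subseteq> A" "lin_indep (\<lambda>i. g i x) B" and "\<kappa> > 0"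
    and ev': "\<forall>\<^sub>F y in nhds x. span ((\<lambda>i. g i y) ` B) = span ((\<lambda>i. g i y) ` A) \<and>
       (\<forall>c::real^'m. (\<forall>i. i \<notin> B \<longrightarrow> c $ i = 0) \<longrightarrow>
          \<kappa> * norm c \<le> norm (\<Sum>i\<in>UNIV. c $ i *\<^sub>R g i y))"
    by (rule constant_rank_basis[of V x g A, OF V rank cont])
  have ev: "\<forall>\<^sub>F y in nhds x. span ((\<lambda>i. g i y) ` B) = span ((\<lambda>i. g i y) ` A)"
    using ev' by (rule eventually_mono) blast
  obtain d where d: "\<And>i j. i \<in> B \<Longrightarrow> j \<in> B \<Longrightarrow> inner (g i x) (d j) = (if i = j then 1 else 0)"
    using lin_indep_dual[OF _ B(2)] by auto
  \<comment> \<open>The dual vectors make the derivative of this map at \<open>x\<close> the identity.\<close>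
  define F where "F y = y + (\<Sum>b\<in>B. (q b y - q b x - inner (g b x) (y - x)) *\<^sub>R d b)" for y
  define F' where "F' y = id_blinfun +
      (\<Sum>b\<in>B. blinfun_scaleR_left (d b) o\<^sub>L blinfun_inner_right (g b y - g b x))" for y
  have F'_apply: "blinfun_apply (F' y) = (\<lambda>h. h + (\<Sum>b\<in>B. inner (g b y - g b x) h *\<^sub>R d b))" for y
    by (rule ext) (simp add: F'_def blinfun.bilinear_simps blinfun_compose.rep_eq)
  have F: "(F has_derivative blinfun_apply (F' y)) (at y)" for y
    unfolding F_def F'_apply
    by (rule q derivative_eq_intros | simp add: inner_diff_left)+
  have contF': "continuous_on UNIV F'"
    unfolding F'_def by (intro continuous_intros g)
  have "id_blinfun o\<^sub>L F' x = id_blinfun"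
    by (rule blinfun_eqI) (simp add: F'_apply blinfun_compose.rep_eq)
  then obtain U' W G G' where W: "open W" "F x \<in> W" and hom: "homeomorphism U' W F G" "x \<in> U'"
    and G: "\<And>y. y \<in> W \<Longrightarrow> (G has_derivative (G' y)) (at y)"
    and G': "\<And>y. y \<in> W \<Longrightarrow> G' y = inv (blinfun_apply (F' (G y)))"
    using inverse_function_theorem[OF open_UNIV F contF' UNIV_I] by metis
  have Fx: "F x = x" by (simp add: F_def)
  have Gx: "G x = x"
    using hom Fx unfolding homeomorphism_def by metis
  have G'x: "G' x w = w"
    using G'[of x] W by (simp add: Fx Gx F'_apply)
  have contG: "isCont G x"
    using has_derivative_continuous[OF G] W Fx by metis
  have line: "isCont (\<lambda>s. x + s *\<^sub>R w) 0"
    by (intro continuous_intros)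
  have "\<forall>\<^sub>F y in nhds x. y \<in> W \<and> span ((\<lambda>i. g i (G y)) ` B) = span ((\<lambda>i. g i (G y)) ` A)"
  proof (rule eventually_conj)
    show "\<forall>\<^sub>F y in nhds x. y \<in> W"
      using W Fx by (simp add: eventually_nhds_in_open)
    have "filterlim G (nhds x) (nhds x)"
      using contG Gx by (simp add: isCont_def tendsto_nhds_iff)
    then show "\<forall>\<^sub>F y in nhds x. span ((\<lambda>i. g i (G y)) ` B) = span ((\<lambda>i. g i (G y)) ` A)"
      using ev by (auto simp: filterlim_iff)
  qed
  moreover have "filterlim (\<lambda>s. x + s *\<^sub>R w) (nhds x) (nhds (0::real))"
    using line by (simp add: isCont_def tendsto_nhds_iff)
  ultimately have "\<forall>\<^sub>F s::real in nhds 0. x + s *\<^sub>R w \<in> W \<and>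
      span ((\<lambda>i. g i (G (x + s *\<^sub>R w))) ` B) = span ((\<lambda>i. g i (G (x + s *\<^sub>R w))) ` A)"
    unfolding filterlim_iff by blast
  then obtain e where e: "e > 0" and near: "\<And>s::real. \<bar>s\<bar> < e \<Longrightarrow> x + s *\<^sub>R w \<in> W"
    "\<And>s::real. \<bar>s\<bar> < e \<Longrightarrow> span ((\<lambda>i. g i (G (x + s *\<^sub>R w))) ` B) = span ((\<lambda>i. g i (G (x + s *\<^sub>R w))) ` A)"
    unfolding eventually_nhds_metric by (auto simp: dist_real_def)
  define \<xi> where "\<xi> s = G (x + s *\<^sub>R w)" for s
  define \<xi>' where "\<xi>' s = G' (x + s *\<^sub>R w) w" for s
  have F\<xi>: "F (\<xi> s) = x + s *\<^sub>R w" if "\<bar>s\<bar> < e" for s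
    using hom(1) near(1)[OF that] by (simp add: homeomorphism_def \<xi>_def)
  have qB: "q b (\<xi> s) = q b x" if s: "\<bar>s\<bar> < e" and b: "b \<in> B" for b s
  proof -
    \<comment> \<open>Pairing with \<open>g b x\<close> isolates one summand and turns
      \<open>F\<close> into \<open>q b\<close> up to a constant:
      \<open>inner (g b x) (F y) = inner (g b x) x + q b y - q b x\<close>. As \<open>w\<close> is
      orthogonal to \<open>g b x\<close>, the local inverse maps the segment into a level set of
      \<open>q b\<close>.\<close>
    have "inner (g b x) (\<Sum>b'\<in>B. (q b' (\<xi> s) - q b' x - inner (g b' x) (\<xi> s - x)) *\<^sub>R d b') =
        (\<Sum>b'\<in>B. if b = b' then q b' (\<xi> s) - q b' x - inner (g b' x) (\<xi> s - x) else 0)"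
      unfolding inner_sum_right by (intro sum.cong refl) (use d b in auto)
    also have "\<dots> = q b (\<xi> s) - q b x - inner (g b x) (\<xi> s - x)"
      using b by simp
    finally have "inner (g b x) (F (\<xi> s)) = inner (g b x) x + q b (\<xi> s) - q b x"
      by (simp add: F_def inner_add_right inner_diff_right)
    then show ?thesis
      using F\<xi>[OF s] w[of b] B(1) b by (auto simp: inner_add_right)
  qed
  have q\<xi>: "((\<lambda>s. q i (\<xi> s)) has_real_derivative inner (g i (\<xi> s)) (\<xi>' s)) (at s)" if "\<bar>s\<bar> < e" for i s
  proof -
    have "bounded_linear (G' (x + s *\<^sub>R w))"
      using G[OF near(1)[OF that]] by (rule has_derivative_bounded_linear)
    then have lin: "G' (x + s *\<^sub>R w) (h *\<^sub>R w) = h *\<^sub>R \<xi>' s" for h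
      by (simp add: \<xi>'_def linear_simps)
    have "((\<lambda>s. x + s *\<^sub>R w) has_derivative (\<lambda>h. h *\<^sub>R w)) (at s)"
      by (auto intro!: derivative_eq_intros)
    from has_derivative_compose[OF has_derivative_compose[OF this G[OF near(1)[OF that]]] q[of i]]
    show ?thesis
      unfolding has_field_derivative_def \<xi>_def[symmetric] lin by (simp add: mult_commute_abs)
  qed
  have "inner (g i (\<xi> s)) (\<xi>' s) = 0" if s: "\<bar>s\<bar> < e" and i: "i \<in> A" for i s
  proof -
    have "inner (g b (\<xi> s)) (\<xi>' s) = 0" if b: "b \<in> B" for b
    proof -
      have "((\<lambda>s. q b (\<xi> s)) has_real_derivative 0) (at s)"
      proof (rule has_field_derivative_transform_within_open[of "\<lambda>_. q b x"])
        show "((\<lambda>_. q b x) has_real_derivative 0) (at s)" by simp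
        show "open {-e<..<e}" "s \<in> {-e<..<e}" using s by auto
        show "q b x = q b (\<xi> r)" if "r \<in> {-e<..<e}" for r
          using qB[of r b] that b by auto
      qed
      then show ?thesis
        using q\<xi>[OF s] DERIV_unique by blast
    qed
    then have "span ((\<lambda>i. g i (\<xi> s)) ` B) \<subseteq> {v. inner v (\<xi>' s) = 0}"
      by (intro span_minimal) (auto simp: subspace_def inner_add_left)
    moreover have "g i (\<xi> s) \<in> span ((\<lambda>i. g i (\<xi> s)) ` A)"
      using i by (intro span_base) auto
    ultimately show ?thesis
      using near(2)[OF s] unfolding \<xi>_def by blast
  qed
  then have D0: "((\<lambda>s. q i (\<xi> s)) has_real_derivative 0) (at s within {-e<..<e})"
    if "s \<in> {-e<..<e}" "i \<in> A" for i s
    using q\<xi>[of s i] that by (force intro: DERIV_subset)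
  have const: "q i (\<xi> s) = q i x" if s: "\<bar>s\<bar> < e" and i: "i \<in> A" for i s
  proof -
    obtain c where "\<And>s. s \<in> {-e<..<e} \<Longrightarrow> q i (\<xi> s) = c"
      using has_field_derivative_zero_constant[of "{-e<..<e}" "\<lambda>s. q i (\<xi> s)"] D0[OF _ i]
      by auto
    from this[of s] this[of 0] show ?thesis
      using s e by (auto simp: \<xi>_def Gx abs_less_iff)
  qed
  \<comment> \<open>The index \<open>Suc k\<close> makes the largest step \<open>e/2\<close>, so
    every step stays below \<open>e\<close>.\<close>
  define t where "t k = (e/2) * inverse (real (Suc k))" for k
  have t: "\<And>k. t k > 0" "t \<longlonglongrightarrow> 0"
    using e LIMSEQ_inverse_real_of_nat unfolding t_def
    by (auto intro!: tendsto_eq_intros)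
  have te: "\<bar>t k\<bar> < e" for k
    using e by (simp add: t_def divide_simps)
  show thesis
  proof (rule that[OF t])
    \<comment> \<open>The direction is the difference quotient of \<open>G\<close>, so that moving
      from \<open>x\<close> by \<open>t k\<close> along it lands exactly on the curve point
      \<open>\<xi> (t k)\<close>.\<close>
    show "(\<lambda>k. (G (x + t k *\<^sub>R w) - G x) /\<^sub>R t k) \<longlonglongrightarrow> w"
      using has_derivative_along_sequence[OF G[of x] t tendsto_const[of w]] W Fx G'x by simp
    show "q i (x + t k *\<^sub>R ((G (x + t k *\<^sub>R w) - G x) /\<^sub>R t k)) = q i x" if "i \<in> A" for i k
      using const[OF te that] t(1)[of k] by (simp add: \<xi>_def Gx)
  qed
qed

subsection \<open>Bounded multipliers\<close>

text \<open>Lets a basis of the equality gradients replace \<open>E\<close> inside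
  \<open>E \<union> J\<close> without changing the rank.\<close>

lemma span_Un_cong: "span A = span B \<Longrightarrow> span (A \<union> C) = span (B \<union> C)"
  by (simp add: span_Un)

text \<open>Coefficients on \<open>F\<close> are unrestricted in sign and \<open>F\<close> is never
  reduced; only the positive support in \<open>N\<close> is minimised. Any dependence involving that
  support could be subtracted until one more coefficient reaches zero.\<close>

lemma conic_caratheodory:
  fixes a :: "'m::finite \<Rightarrow> 'b::real_vector"
  assumes ind: "lin_indep a F" and disj: "F \<inter> N = {}"
    and lam: "\<And>i. i \<notin> F \<union> N \<Longrightarrow> lam $ i = 0" "\<And>i. i \<in> N \<Longrightarrow> lam $ i \<ge> 0"
  obtains \<mu> :: "real^'m" where "(\<Sum>i\<in>UNIV. \<mu> $ i *\<^sub>R a i) = (\<Sum>i\<in>UNIV. lam $ i *\<^sub>R a i)"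
    "\<And>i. i \<notin> F \<union> N \<Longrightarrow> \<mu> $ i = 0" "\<And>i. i \<in> N \<Longrightarrow> \<mu> $ i \<ge> 0"
    "lin_indep a (F \<union> {i\<in>N. \<mu> $ i > 0})"
proof -
  define S where "S \<mu> = (\<Sum>i\<in>UNIV. \<mu> $ i *\<^sub>R a i)" for \<mu> :: "real^'m"
  define ok where "ok \<mu> \<longleftrightarrow> S \<mu> = S lam \<and> (\<forall>i. i \<notin> F \<union> N \<longrightarrow> \<mu> $ i = 0) \<and> (\<forall>i\<in>N. \<mu> $ i \<ge> 0)" for \<mu>
  have "ok lam" using lam by (simp add: ok_def)
  then obtain \<mu> where ok: "ok \<mu>"
    and least: "\<And>\<nu>. ok \<nu> \<Longrightarrow> card {i\<in>N. \<mu> $ i > 0} \<le> card {i\<in>N. \<nu> $ i > 0}"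
    using ex_has_least_nat[of ok lam "\<lambda>\<mu>. card {i\<in>N. \<mu> $ i > 0}"] by blast
  define J where "J = {i\<in>N. \<mu> $ i > 0}"
  have no_pos: "c j \<le> 0" if c: "(\<Sum>i\<in>F \<union> J. c i *\<^sub>R a i) = 0" and j: "j \<in> J" for c j
  proof (rule ccontr)
    assume "\<not> c j \<le> 0"
    define P where "P = {i\<in>J. c i > 0}"
    \<comment> \<open>This is the longest step that keeps all coefficients on \<open>J\<close>
      nonnegative; the index \<open>p\<close> attaining it drops out of the support.\<close>
    define s where "s = Min ((\<lambda>i. \<mu> $ i / c i) ` P)"
    have P: "finite P" "P \<noteq> {}" using \<open>\<not> c j \<le> 0\<close> j by (auto simp: P_def)
    have s_le: "s \<le> \<mu> $ i / c i" if "i \<in> P" for i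
      unfolding s_def using P that by (intro Min_le) auto
    have "s \<in> (\<lambda>i. \<mu> $ i / c i) ` P"
      unfolding s_def using P by (intro Min_in) auto
    then obtain p where p: "p \<in> P" "s = \<mu> $ p / c p"
      by blast
    have s: "s > 0" using p by (simp add: P_def J_def)
    define \<nu> :: "real^'m" where "\<nu> = (\<chi> i. \<mu> $ i - (if i \<in> F \<union> J then s * c i else 0))"
    have "(\<Sum>i\<in>UNIV. (if i \<in> F \<union> J then s * c i else 0) *\<^sub>R a i) = (\<Sum>i\<in>F \<union> J. s *\<^sub>R (c i *\<^sub>R a i))"
      by (intro sum.mono_neutral_cong_right) auto
    also have "\<dots> = 0"
      using c by (simp only: scaleR_sum_right[symmetric] scaleR_zero_right)
    finally have "S \<nu> = S \<mu>"
      by (simp add: S_def \<nu>_def scaleR_diff_left sum_subtractf)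
    moreover have nonneg: "\<nu> $ i \<ge> 0" if i: "i \<in> N" for i
    proof (cases "i \<in> J")
      case True
      show ?thesis
      proof (cases "c i > 0")
        case True
        with \<open>i \<in> J\<close> have "s * c i \<le> \<mu> $ i"
          using s_le[of i] by (simp add: P_def pos_le_divide_eq)
        then show ?thesis using \<open>i \<in> J\<close> by (simp add: \<nu>_def)
      next
        case False
        then have "s * c i \<le> 0" using s by (simp add: mult_le_0_iff)
        then show ?thesis using \<open>i \<in> J\<close> by (simp add: \<nu>_def J_def)
      qed
    next
      case False
      then show ?thesis
        using i disj ok by (auto simp: \<nu>_def ok_def)
    qed
    moreover have "\<nu> $ i = 0" if "i \<notin> F \<union> N" for i
      using that ok by (auto simp: \<nu>_def ok_def J_def)
    ultimately have "ok \<nu>" using ok by (simp add: ok_def)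
    moreover have "{i\<in>N. \<nu> $ i > 0} \<subset> J"
    proof
      show "{i\<in>N. \<nu> $ i > 0} \<subseteq> J"
      proof (rule subsetI, rule ccontr)
        fix i assume i: "i \<in> {i\<in>N. \<nu> $ i > 0}" "i \<notin> J"
        then have "i \<notin> F" using disj by auto
        then have "\<nu> $ i = \<mu> $ i" using i by (simp add: \<nu>_def)
        then show False using i by (simp add: J_def)
      qed
      have "\<nu> $ p = 0" "p \<in> J" using p by (auto simp: \<nu>_def P_def)
      then show "{i\<in>N. \<nu> $ i > 0} \<noteq> J" by auto
    qed
    ultimately show False
      using least[of \<nu>] psubset_card_mono[of J "{i\<in>N. \<nu> $ i > 0}"] by (simp add: J_def)
  qed
  have "lin_indep a (F \<union> J)"
    unfolding lin_indep_def
  proof (intro allI impI)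
    fix c assume c: "(\<Sum>i\<in>F \<union> J. c i *\<^sub>R a i) = 0"
    \<comment> \<open>Negating the dependence excludes negative coefficients on \<open>J\<close>
      too, so the dependence lives on \<open>F\<close> alone.\<close>
    then have "(\<Sum>i\<in>F \<union> J. (- c i) *\<^sub>R a i) = 0"
      by (simp add: sum_negf)
    from no_pos[OF this] no_pos[OF c] have J0: "\<forall>j\<in>J. c j = 0"
      by force
    then have "(\<Sum>i\<in>F. c i *\<^sub>R a i) = (\<Sum>i\<in>F \<union> J. c i *\<^sub>R a i)"
      by (intro sum.mono_neutral_left) auto
    then show "\<forall>i\<in>F \<union> J. c i = 0"
      using ind c J0 unfolding lin_indep_def by auto
  qed
  then show thesis
    using that[of \<mu>] ok by (simp add: ok_def S_def J_def)
qed

text \<open>The index set \<open>M\<close> is left arbitrary inside \<open>N\<close> because active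
  sets at nearby points may be smaller than at \<open>z\<close>. The reduced support is independent
  at the variable point \<open>x\<close>; equality of ranks carries this back to \<open>z\<close>,
  where only finitely many independent families occur. The constant \<open>\<gamma>\<close> is the
  reciprocal of the smallest of their lower bounds.\<close>

lemma bounded_multipliers:
  fixes g :: "'m::finite \<Rightarrow> 'a::t2_space \<Rightarrow> 'b::euclidean_space"
  assumes V: "open V" "z \<in> V" and disj: "E \<inter> N = {}"
    and rank: "\<And>J x. J \<subseteq> N \<Longrightarrow> x \<in> V \<Longrightarrow>
        dim ((\<lambda>i. g i x) ` (E \<union> J)) = dim ((\<lambda>i. g i z) ` (E \<union> J))"
    and cont: "\<And>i. isCont (g i) z"
  obtains \<gamma> where "\<gamma> > 0"
    "\<forall>\<^sub>F x in nhds z. \<forall>M lam. M \<subseteq> N \<longrightarrow> (\<forall>i. i \<notin> E \<union> M \<longrightarrow> lam $ i = 0) \<longrightarrow> (\<forall>i\<in>M. lam $ i \<ge> 0) \<longrightarrow>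
       (\<exists>\<mu>::real^'m. (\<Sum>i\<in>UNIV. \<mu> $ i *\<^sub>R g i x) = (\<Sum>i\<in>UNIV. lam $ i *\<^sub>R g i x) \<and>
          (\<forall>i. i \<notin> E \<union> M \<longrightarrow> \<mu> $ i = 0) \<and> (\<forall>i\<in>M. \<mu> $ i \<ge> 0) \<and>
          norm \<mu> \<le> \<gamma> * norm (\<Sum>i\<in>UNIV. lam $ i *\<^sub>R g i x))"
proof -
  have rankE: "dim ((\<lambda>i. g i x) ` E) = dim ((\<lambda>i. g i z) ` E)" if "x \<in> V" for x
    using rank[of "{}" x] that by simp
  obtain F \<kappa>\<^sub>0 where F: "F \<subseteq> E" "lin_indep (\<lambda>i. g i z) F" and "\<kappa>\<^sub>0 > 0"
    and ev0: "\<forall>\<^sub>F x in nhds z. span ((\<lambda>i. g i x) ` F) = span ((\<lambda>i. g i x) ` E) \<and>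
       (\<forall>c::real^'m. (\<forall>i. i \<notin> F \<longrightarrow> c $ i = 0) \<longrightarrow>
          \<kappa>\<^sub>0 * norm c \<le> norm (\<Sum>i\<in>UNIV. c $ i *\<^sub>R g i x))"
    by (rule constant_rank_basis[of V z g E, OF V rankE cont])
  define bnd where "bnd B \<kappa> x \<longleftrightarrow> (\<forall>c::real^'m. (\<forall>i. i \<notin> B \<longrightarrow> c $ i = 0) \<longrightarrow>
        \<kappa> * norm c \<le> norm (\<Sum>i\<in>UNIV. c $ i *\<^sub>R g i x))" for B \<kappa> x
  define \<J> where "\<J> = {J. J \<subseteq> N \<and> lin_indep (\<lambda>i. g i z) (F \<union> J)}"
  have "\<exists>\<kappa>. \<forall>J\<in>\<J>. \<kappa> J > 0 \<and> (\<forall>\<^sub>F x in nhds z. bnd (F \<union> J) (\<kappa> J) x)"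
  proof (intro bchoice ballI)
    fix J assume "J \<in> \<J>"
    then have "lin_indep (\<lambda>i. g i z) (F \<union> J)" by (simp add: \<J>_def)
    from lin_indep_bounded_below[OF this cont]
    show "\<exists>\<kappa>. \<kappa> > 0 \<and> (\<forall>\<^sub>F x in nhds z. bnd (F \<union> J) \<kappa> x)"
      unfolding bnd_def by blast
  qed
  then obtain \<kappa> where \<kappa>: "\<And>J. J \<in> \<J> \<Longrightarrow> \<kappa> J > 0"
    "\<And>J. J \<in> \<J> \<Longrightarrow> \<forall>\<^sub>F x in nhds z. bnd (F \<union> J) (\<kappa> J) x" by blast
  have "{} \<in> \<J>" using F by (simp add: \<J>_def)
  have fin: "finite \<J>" by simp
  define m where "m = Min (\<kappa> ` \<J>)"
  have m: "m > 0"
    unfolding m_def using fin \<open>{} \<in> \<J>\<close> \<kappa>(1) by (subst Min_gr_iff) auto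
  have m_le: "m \<le> \<kappa> J" if "J \<in> \<J>" for J
    unfolding m_def using fin that by simp
  have "\<forall>\<^sub>F x in nhds z. \<forall>J\<in>\<J>. bnd (F \<union> J) (\<kappa> J) x"
    using fin \<kappa>(2) by (simp add: eventually_ball_finite)
  moreover have "\<forall>\<^sub>F x in nhds z. x \<in> V"
    using V by (rule eventually_nhds_in_open)
  ultimately have "\<forall>\<^sub>F x in nhds z. \<forall>M lam. M \<subseteq> N \<longrightarrow> (\<forall>i. i \<notin> E \<union> M \<longrightarrow> lam $ i = 0) \<longrightarrow> (\<forall>i\<in>M. lam $ i \<ge> 0) \<longrightarrow>
       (\<exists>\<mu>::real^'m. (\<Sum>i\<in>UNIV. \<mu> $ i *\<^sub>R g i x) = (\<Sum>i\<in>UNIV. lam $ i *\<^sub>R g i x) \<and>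
          (\<forall>i. i \<notin> E \<union> M \<longrightarrow> \<mu> $ i = 0) \<and> (\<forall>i\<in>M. \<mu> $ i \<ge> 0) \<and>
          norm \<mu> \<le> inverse m * norm (\<Sum>i\<in>UNIV. lam $ i *\<^sub>R g i x))"
    using ev0
  proof eventually_elim
    case (elim x)
    have spx: "span ((\<lambda>i. g i x) ` F) = span ((\<lambda>i. g i x) ` E)"
      using elim by blast
    have spz: "span ((\<lambda>i. g i z) ` F) = span ((\<lambda>i. g i z) ` E)"
      using eventually_nhds_x_imp_x[OF ev0] by blast
    show ?case
    proof (intro allI impI)
      fix M and lam :: "real^'m"
      assume M: "M \<subseteq> N" and lam: "\<forall>i. i \<notin> E \<union> M \<longrightarrow> lam $ i = 0" "\<forall>i\<in>M. lam $ i \<ge> 0"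
      have "(\<Sum>i\<in>E. lam $ i *\<^sub>R g i x) \<in> span ((\<lambda>i. g i x) ` E)"
        by (intro span_sum span_scale span_base) auto
      then obtain c :: "real^'m" where c: "\<And>i. i \<notin> F \<Longrightarrow> c $ i = 0"
        "(\<Sum>i\<in>E. lam $ i *\<^sub>R g i x) = (\<Sum>i\<in>UNIV. c $ i *\<^sub>R g i x)"
        using span_image_coeffs[of "\<Sum>i\<in>E. lam $ i *\<^sub>R g i x" "\<lambda>i. g i x" F] spx by blast
      \<comment> \<open>The part on \<open>E\<close> is rewritten in the basis \<open>F\<close>,
        which absorbs possibly dependent equality gradients; the sign-restricted part on
        \<open>M\<close> is kept for the reduction.\<close>
      define \<nu> :: "real^'m" where "\<nu> = (\<chi> i. if i \<in> M then lam $ i else c $ i)"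
      have FM: "F \<inter> M = {}" "E \<inter> M = {}" using F disj M by auto
      have "(\<Sum>i\<in>UNIV. \<nu> $ i *\<^sub>R g i x) = (\<Sum>i\<in>UNIV. c $ i *\<^sub>R g i x) + (\<Sum>i\<in>UNIV. (if i \<in> M then lam $ i else 0) *\<^sub>R g i x)"
        unfolding sum.distrib[symmetric] using c(1) FM
        by (intro sum.cong) (auto simp: \<nu>_def)
      also have "(\<Sum>i\<in>UNIV. (if i \<in> M then lam $ i else 0) *\<^sub>R g i x) = (\<Sum>i\<in>M. lam $ i *\<^sub>R g i x)"
        by (intro sum.mono_neutral_cong_right) auto
      also have "(\<Sum>i\<in>UNIV. c $ i *\<^sub>R g i x) + (\<Sum>i\<in>M. lam $ i *\<^sub>R g i x) = (\<Sum>i\<in>E \<union> M. lam $ i *\<^sub>R g i x)"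
        using c(2) FM by (simp add: sum.union_disjoint)
      also have "\<dots> = (\<Sum>i\<in>UNIV. lam $ i *\<^sub>R g i x)"
        using lam(1) by (intro sum.mono_neutral_left) auto
      finally have \<nu>: "(\<Sum>i\<in>UNIV. \<nu> $ i *\<^sub>R g i x) = (\<Sum>i\<in>UNIV. lam $ i *\<^sub>R g i x)" .
      have "lin_indep (\<lambda>i. g i x) F"
        using F(2) rankE[of x] elim spx spz by (metis dim_span finite lin_indep_iff_dim)
      then obtain \<mu> :: "real^'m" where \<mu>: "(\<Sum>i\<in>UNIV. \<mu> $ i *\<^sub>R g i x) = (\<Sum>i\<in>UNIV. \<nu> $ i *\<^sub>R g i x)"
        "\<And>i. i \<notin> F \<union> M \<Longrightarrow> \<mu> $ i = 0" "\<And>i. i \<in> M \<Longrightarrow> \<mu> $ i \<ge> 0"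
        "lin_indep (\<lambda>i. g i x) (F \<union> {i\<in>M. \<mu> $ i > 0})"
        by (rule conic_caratheodory[OF _ FM(1), of _ \<nu>]) (use lam c(1) in \<open>auto simp: \<nu>_def\<close>)
      define J where "J = {i\<in>M. \<mu> $ i > 0}"
      have J: "J \<subseteq> N" using M by (auto simp: J_def)
      have "dim ((\<lambda>i. g i z) ` (F \<union> J)) = dim ((\<lambda>i. g i z) ` (E \<union> J))"
        using span_Un_cong[OF spz] by (metis dim_span image_Un)
      also have "\<dots> = dim ((\<lambda>i. g i x) ` (E \<union> J))"
        using rank[OF J] elim by simp
      also have "\<dots> = dim ((\<lambda>i. g i x) ` (F \<union> J))"
        using span_Un_cong[OF spx] by (metis dim_span image_Un)
      also have "\<dots> = card (F \<union> J)"
        using \<mu>(4) by (simp add: J_def lin_indep_iff_dim)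
      finally have "J \<in> \<J>"
        using J by (simp add: \<J>_def lin_indep_iff_dim)
      moreover have "\<mu> $ i = 0" if "i \<notin> F \<union> J" for i
        using that \<mu>(2)[of i] \<mu>(3)[of i] by (force simp: J_def)
      ultimately have "\<kappa> J * norm \<mu> \<le> norm (\<Sum>i\<in>UNIV. \<mu> $ i *\<^sub>R g i x)"
        using elim unfolding bnd_def by blast
      then have "m * norm \<mu> \<le> norm (\<Sum>i\<in>UNIV. lam $ i *\<^sub>R g i x)"
        using m_le[OF \<open>J \<in> \<J>\<close>] mult_right_mono[of m "\<kappa> J" "norm \<mu>"] \<mu>(1) \<nu> by simp
      then have "norm \<mu> \<le> inverse m * norm (\<Sum>i\<in>UNIV. lam $ i *\<^sub>R g i x)"
        using m by (simp add: field_simps)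
      then show "\<exists>\<mu>::real^'m. (\<Sum>i\<in>UNIV. \<mu> $ i *\<^sub>R g i x) = (\<Sum>i\<in>UNIV. lam $ i *\<^sub>R g i x) \<and>
          (\<forall>i. i \<notin> E \<union> M \<longrightarrow> \<mu> $ i = 0) \<and> (\<forall>i\<in>M. \<mu> $ i \<ge> 0) \<and>
          norm \<mu> \<le> inverse m * norm (\<Sum>i\<in>UNIV. lam $ i *\<^sub>R g i x)"
        using \<mu>(1-3) \<nu> F(1) by (intro exI[of _ \<mu>]) auto
    qed
  qed
  then show thesis
    using that[of "inverse m"] m by simp
qed

subsection \<open>Constraint systems\<close>

lemma hess_lag_mult: "hess_lag hq lam x *v w = (\<Sum>i\<in>UNIV. lam $ i *\<^sub>R (hq i x *v w))"
proof -
  have "(\<Sum>i\<in>S. lam $ i *\<^sub>R hq i x) *v w = (\<Sum>i\<in>S. lam $ i *\<^sub>R (hq i x *v w))" for S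
    by (induction S rule: infinite_finite_induct)
       (simp_all add: matrix_vector_mult_add_rdistrib scaleR_matrix_vector_assoc)
  then show ?thesis by (simp add: hess_lag_def)
qed

lemma sum_nonpos_eq_0_imp:
  fixes f :: "'m::finite \<Rightarrow> real"
  assumes "\<And>i. f i \<le> 0" "(\<Sum>i\<in>UNIV. f i) = 0"
  shows "f i = 0"
  using sum_nonneg_eq_0_iff[of UNIV "\<lambda>i. - f i"] assms by (simp add: sum_negf)

lemma mem_Gamma_iff: "x \<in> Gamma q E I \<longleftrightarrow> (\<forall>i\<in>E. q i x = 0) \<and> (\<forall>i\<in>I. q i x \<le> 0)"
  by (simp add: Gamma_def Theta_def qvec_def)

lemma multipliers_active:
  assumes "lam \<in> multipliers q gq I x xs" "i \<in> I" "lam $ i \<noteq> 0"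
  shows "i \<in> active_set q I x" "lam $ i > 0"
  using assms by (force simp: multipliers_def active_set_def)+

lemma Iplus_subset_active: "Iplus q gq I x xs \<subseteq> active_set q I x"
  by (auto simp: Iplus_def Iplus_lam_def multipliers_def active_set_def)

section \<open>Consequences of differentiability alone: tangents are linearized, multipliers give
  normals\<close>

locale constraint_system =
  fixes q :: "'m::finite \<Rightarrow> real^'n \<Rightarrow> real"
    and gq :: "'m \<Rightarrow> real^'n \<Rightarrow> real^'n"
    and hq :: "'m \<Rightarrow> real^'n \<Rightarrow> real^'n^'n"
    and E I :: "'m set"
  assumes partition: "E \<inter> I = {}" "E \<union> I = UNIV"
    and grad: "\<And>i x. (q i has_derivative (\<lambda>h. inner (gq i x) h)) (at x)"
    and hess: "\<And>i x. (gq i has_derivative (\<lambda>h. hq i x *v h)) (at x)"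
begin

lemma q_continuous: "isCont (q i) x"
  using grad by (rule has_derivative_continuous)

lemma gq_continuous: "isCont (gq i) x"
  using hess by (rule has_derivative_continuous)

lemma E_or_I: "i \<in> E \<or> i \<in> I"
  using partition(2) by blast

lemma closed_Gamma: "closed (Gamma q E I)"
proof -
  have "Gamma q E I = (\<Inter>i\<in>E. {x. q i x = 0}) \<inter> (\<Inter>i\<in>I. {x. q i x \<le> 0})"
    by (auto simp: mem_Gamma_iff)
  moreover have "continuous_on UNIV (q i)" for i
    using q_continuous by (simp add: continuous_on_eq_continuous_at)
  ultimately show ?thesis
    by (auto intro!: closed_Int closed_INT closed_Collect_eq closed_Collect_le continuous_intros)
qed

definition linearized_cone :: "real^'n \<Rightarrow> (real^'n) set" where
  "linearized_cone x = {u. (\<forall>i\<in>E. inner (gq i x) u = 0) \<and> (\<forall>i\<in>active_set q I x. inner (gq i x) u \<le> 0)}"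

lemma tangent_cone_subset_linearized:
  assumes x: "x \<in> Gamma q E I"
  shows "tangent_cone (Gamma q E I) x \<subseteq> linearized_cone x"
proof
  fix u assume "u \<in> tangent_cone (Gamma q E I) x"
  then obtain t uu where t: "\<And>k. t k > (0::real)" "t \<longlonglongrightarrow> 0" and uu: "uu \<longlonglongrightarrow> u"
    and mem: "\<And>k. x + t k *\<^sub>R uu k \<in> Gamma q E I"
    unfolding tangent_cone_def by auto
  note lim = has_derivative_along_sequence[OF grad t uu]
  have "inner (gq i x) u = 0" if "i \<in> E" for i
    using lim[of i x] x mem that by (simp add: mem_Gamma_iff LIMSEQ_const_iff)
  moreover have "inner (gq i x) u \<le> 0" if i: "i \<in> active_set q I x" for i
  proof (rule LIMSEQ_le_const2[OF lim[of i x]], intro exI allI impI)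
    fix k
    have "q i (x + t k *\<^sub>R uu k) \<le> 0" "q i x = 0"
      using i mem[of k] by (auto simp: mem_Gamma_iff active_set_def)
    then show "(q i (x + t k *\<^sub>R uu k) - q i x) /\<^sub>R t k \<le> 0"
      using t(1)[of k] by (simp add: mult_nonneg_nonpos)
  qed
  ultimately show "u \<in> linearized_cone x"
    by (simp add: linearized_cone_def)
qed

text \<open>The combination \<open>f\<close> of the constraints has gradient \<open>xs\<close>,
  vanishes at \<open>x\<close> by complementarity and is nonpositive on the feasible set by the sign
  conditions, so its first-order expansion yields the defining inequality.\<close>

lemma multipliers_regular_normal:
  assumes x: "x \<in> Gamma q E I" and lam: "lam \<in> multipliers q gq I x xs"
  shows "xs \<in> regular_normal_cone (Gamma q E I) x"
  unfolding mem_regular_normal_cone_iff eventually_at_filter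
proof (intro allI impI)
  fix e :: real assume "e > 0"
  define f where "f y = (\<Sum>i\<in>UNIV. lam $ i * q i y)" for y
  have "(f has_derivative (\<lambda>h. \<Sum>i\<in>UNIV. lam $ i * inner (gq i x) h)) (at x)"
    unfolding f_def by (intro derivative_intros grad)
  moreover have "(\<Sum>i\<in>UNIV. lam $ i * inner (gq i x) h) = inner xs h" for h
    using lam by (auto simp: multipliers_def inner_sum_left)
  ultimately have "(f has_derivative inner xs) (at x)" by simp
  then obtain d where d: "d > 0" and
    le: "\<And>y. norm (y - x) < d \<Longrightarrow> norm (f y - f x - inner xs (y - x)) \<le> e * norm (y - x)"
    using \<open>e > 0\<close> unfolding has_derivative_at_alt by blast
  have fx: "f x = 0"
    unfolding f_def using x lam E_or_I by (intro sum.neutral) (force simp: mem_Gamma_iff multipliers_def)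
  show "\<forall>\<^sub>F y in nhds x. y \<noteq> x \<longrightarrow> y \<in> Gamma q E I \<longrightarrow> inner xs (y - x) \<le> e * norm (y - x)"
    unfolding eventually_nhds_metric
  proof (intro exI[of _ d] conjI allI impI d)
    fix y assume y: "dist y x < d" "y \<in> Gamma q E I"
    have "lam $ i * q i y \<le> 0" for i
      using y(2) lam E_or_I[of i] by (auto simp: mem_Gamma_iff multipliers_def mult_nonneg_nonpos)
    then have "f y \<le> 0"
      unfolding f_def by (intro sum_nonpos) auto
    then show "inner xs (y - x) \<le> e * norm (y - x)"
      using le[of y] y(1) fx by (simp add: dist_norm)
  qed
qed

lemma multipliers_normal:
  assumes "x \<in> Gamma q E I" "lam \<in> multipliers q gq I x xs"
  shows "xs \<in> normal_cone (Gamma q E I) x"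
  unfolding normal_cone_def mem_Collect_eq
  using assms(1) multipliers_regular_normal[OF assms]
  by (intro conjI exI[of _ "\<lambda>k. x"] exI[of _ "\<lambda>k. xs"]) auto

end

text \<open>The constraint qualification in a form valid at each feasible point of \<open>U\<close>:
  constant rank for subsets of the active set of that very point, and one constant bounding a
  multiplier of every normal. The reference point is no longer distinguished.\<close>

locale rcrcq_neighbourhood = constraint_system q gq hq E I
  for q :: "'m::finite \<Rightarrow> real^'n \<Rightarrow> real" and gq hq E I +
  fixes U :: "(real^'n) set" and \<gamma> :: real
  assumes U: "open U"
    and rank: "\<And>x y J. \<lbrakk>x \<in> U; x \<in> Gamma q E I; J \<subseteq> active_set q I x; y \<in> U\<rbrakk> \<Longrightarrow>
        dim ((\<lambda>i. gq i y) ` (E \<union> J)) = dim ((\<lambda>i. gq i x) ` (E \<union> J))"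
    and \<gamma>: "\<gamma> > 0"
    and bounded: "\<And>x xs. \<lbrakk>x \<in> U; x \<in> Gamma q E I; multipliers q gq I x xs \<noteq> {}\<rbrakk> \<Longrightarrow>
        \<exists>lam\<in>multipliers q gq I x xs. norm lam \<le> \<gamma> * norm xs"
begin

text \<open>Active constraints are split by their slope along \<open>w\<close>: those in
  \<open>J\<close> are kept exactly at zero by the curve, strictly decreasing ones become negative,
  and inactive ones stay negative by continuity. Exact vanishing on \<open>J\<close> is what later
  preserves complementarity of perturbed multipliers.\<close>

lemma tangent_sequence:
  assumes x: "x \<in> U" "x \<in> Gamma q E I" and J: "J \<subseteq> active_set q I x"
    and w: "\<And>i. i \<in> E \<union> J \<Longrightarrow> inner (gq i x) w = 0"
      "\<And>i. i \<in> active_set q I x - J \<Longrightarrow> inner (gq i x) w < 0"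
  obtains t u where "\<And>k. t k > (0::real)" "t \<longlonglongrightarrow> 0" "u \<longlonglongrightarrow> w"
    "\<And>k. x + t k *\<^sub>R u k \<in> Gamma q E I"
    "\<And>k i. i \<in> E \<union> J \<Longrightarrow> q i (x + t k *\<^sub>R u k) = 0"
proof -
  have cont: "continuous_on UNIV (gq i)" for i
    using gq_continuous by (simp add: continuous_on_eq_continuous_at)
  obtain t u where t: "\<And>k. t k > (0::real)" "t \<longlonglongrightarrow> 0" and u: "u \<longlonglongrightarrow> w"
    and zero: "\<And>i k. i \<in> E \<union> J \<Longrightarrow> q i (x + t k *\<^sub>R u k) = q i x"
    using constant_rank_tangent[of U x gq "E \<union> J" q w, OF U x(1) rank[OF x J] grad cont w(1)]
    by metis
  have qx: "q i x = 0" if "i \<in> E \<union> J" for i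
    using that x(2) J by (auto simp: mem_Gamma_iff active_set_def)
  have "(\<lambda>k. x + t k *\<^sub>R u k) \<longlonglongrightarrow> x + 0 *\<^sub>R w"
    by (intro tendsto_intros t u)
  then have y: "(\<lambda>k. x + t k *\<^sub>R u k) \<longlonglongrightarrow> x" by simp
  have "\<forall>\<^sub>F k in sequentially. q i (x + t k *\<^sub>R u k) \<le> 0" if i: "i \<in> I" for i
  proof (cases "i \<in> active_set q I x")
    case True
    show ?thesis
    proof (cases "i \<in> J")
      case True
      then show ?thesis using zero[of i] qx[of i] by simp
    next
      case False
      then have "\<forall>\<^sub>F k in sequentially. (q i (x + t k *\<^sub>R u k) - q i x) /\<^sub>R t k < 0"
        using has_derivative_along_sequence[OF grad t u, of i x] w(2)[of i] \<open>i \<in> active_set q I x\<close>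
        by (intro order_tendstoD(2)) auto
      then show ?thesis
      proof eventually_elim
        case (elim k)
        then show ?case
          using t(1)[of k] \<open>i \<in> active_set q I x\<close>
          by (simp add: active_set_def mult_less_0_iff)
      qed
    qed
  next
    case False
    then have "q i x < 0"
      using i x(2) by (force simp: active_set_def mem_Gamma_iff)
    then have "\<forall>\<^sub>F k in sequentially. q i (x + t k *\<^sub>R u k) < 0"
      using isCont_tendsto_compose[OF q_continuous[of x i] y] by (intro order_tendstoD(2))
    then show ?thesis
      by eventually_elim simp
  qed
  then have "\<forall>\<^sub>F k in sequentially. \<forall>i\<in>I. q i (x + t k *\<^sub>R u k) \<le> 0"
    by (simp add: eventually_ball_finite)
  then obtain N where N: "\<And>k i. k \<ge> N \<Longrightarrow> i \<in> I \<Longrightarrow> q i (x + t k *\<^sub>R u k) \<le> 0"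
    unfolding eventually_sequentially by blast
  show thesis
  proof (rule that[of "\<lambda>k. t (k + N)" "\<lambda>k. u (k + N)"])
    show "(\<lambda>k. t (k + N)) \<longlonglongrightarrow> 0" "(\<lambda>k. u (k + N)) \<longlonglongrightarrow> w"
      using t u by (simp_all add: LIMSEQ_ignore_initial_segment)
    show "x + t (k + N) *\<^sub>R u (k + N) \<in> Gamma q E I" for k
      using N[of "k + N"] zero qx by (simp add: mem_Gamma_iff)
    show "q i (x + t (k + N) *\<^sub>R u (k + N)) = 0" if "i \<in> E \<union> J" for i k
      using zero[OF that] qx[OF that] by simp
  qed (use t in auto)
qed

lemma tangent_cone_Gamma:
  assumes x: "x \<in> U" "x \<in> Gamma q E I"
  shows "tangent_cone (Gamma q E I) x = linearized_cone x"
proof (rule antisym[OF tangent_cone_subset_linearized[OF x(2)]], rule subsetI)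
  fix w assume w: "w \<in> linearized_cone x"
  define J where "J = {i\<in>active_set q I x. inner (gq i x) w = 0}"
  have J: "J \<subseteq> active_set q I x" "\<And>i. i \<in> E \<union> J \<Longrightarrow> inner (gq i x) w = 0"
    "\<And>i. i \<in> active_set q I x - J \<Longrightarrow> inner (gq i x) w < 0"
    using w by (auto simp: J_def linearized_cone_def order_less_le)
  obtain t u where "\<And>k. t k > (0::real)" "t \<longlonglongrightarrow> 0" "u \<longlonglongrightarrow> w"
    "\<And>k. x + t k *\<^sub>R u k \<in> Gamma q E I"
    using tangent_sequence[OF x J] by metis
  then show "w \<in> tangent_cone (Gamma q E I) x"
    unfolding tangent_cone_def by blast
qed

lemma regular_normal_multipliers:
  assumes x: "x \<in> U" "x \<in> Gamma q E I" and xs: "xs \<in> regular_normal_cone (Gamma q E I) x"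
  shows "multipliers q gq I x xs \<noteq> {}"
proof -
  have disj: "E \<inter> active_set q I x = {}"
    using partition by (auto simp: active_set_def)
  have le: "inner xs u \<le> 0" if "\<And>i. i \<in> E \<Longrightarrow> inner (gq i x) u = 0"
    "\<And>i. i \<in> active_set q I x \<Longrightarrow> inner (gq i x) u \<le> 0" for u
  proof (rule regular_normal_tangent_le[OF xs])
    show "u \<in> tangent_cone (Gamma q E I) x"
      using that by (simp add: tangent_cone_Gamma[OF x] linearized_cone_def)
  qed
  obtain \<nu> :: "real^'m" where \<nu>: "xs = (\<Sum>i\<in>UNIV. \<nu> $ i *\<^sub>R gq i x)"
    "\<forall>i. i \<notin> E \<union> active_set q I x \<longrightarrow> \<nu> $ i = 0" "\<forall>i\<in>active_set q I x. \<nu> $ i \<ge> 0"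
    by (rule farkas[of E "active_set q I x" "\<lambda>i. gq i x" xs, OF disj le])
  have "\<nu> $ i \<ge> 0 \<and> \<nu> $ i * q i x = 0" if "i \<in> I" for i
    using \<nu>(2,3) that partition by (cases "i \<in> active_set q I x") (auto simp: active_set_def)
  then have "\<nu> \<in> multipliers q gq I x xs"
    using \<nu>(1) by (simp add: multipliers_def)
  then show ?thesis by blast
qed

text \<open>Arbitrary multipliers along the sequence could diverge; the uniform bound selects a
  bounded family, and its cluster points inherit the defining relations. Besides closedness, the
  convergent selection \<open>l\<close> itself is needed for difference quotients on the
  graph.\<close>

lemma multipliers_limit:
  assumes x: "x \<in> U" "x \<in> Gamma q E I"
    and z: "\<And>k. z k \<in> Gamma q E I" "\<And>k. z k \<in> U" "z \<longlonglongrightarrow> x"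
    and zs: "\<And>k. multipliers q gq I (z k) (zs k) \<noteq> {}" "zs \<longlonglongrightarrow> xs"
  obtains lam l r where "lam \<in> multipliers q gq I x xs" "strict_mono r" "l \<longlonglongrightarrow> lam"
    "\<And>k. l k \<in> multipliers q gq I (z (r k)) (zs (r k))"
proof -
  have "\<forall>k. \<exists>l\<in>multipliers q gq I (z k) (zs k). norm l \<le> \<gamma> * norm (zs k)"
    using bounded z zs by blast
  then obtain l where l: "\<And>k. l k \<in> multipliers q gq I (z k) (zs k)" "\<And>k. norm (l k) \<le> \<gamma> * norm (zs k)"
    by metis
  obtain M where M: "\<And>k. norm (zs k) \<le> M"
    using convergent_imp_Bseq[OF convergentI[OF zs(2)]] by (auto simp: Bseq_def)
  have "norm (l k) \<le> \<gamma> * M" for k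
    using l(2)[of k] M[of k] \<gamma> by (smt (verit) mult_left_mono)
  then have "bounded (range l)"
    by (auto simp: bounded_iff)
  then obtain lam r where r: "strict_mono r" "(l \<circ> r) \<longlonglongrightarrow> lam"
    using bounded_imp_convergent_subsequence by blast
  have lr: "(\<lambda>k. l (r k)) \<longlonglongrightarrow> lam" using r by (simp add: o_def)
  have zr: "(\<lambda>k. z (r k)) \<longlonglongrightarrow> x" "(\<lambda>k. zs (r k)) \<longlonglongrightarrow> xs"
    using LIMSEQ_subseq_LIMSEQ[OF z(3) r(1)] LIMSEQ_subseq_LIMSEQ[OF zs(2) r(1)] by (simp_all add: o_def)
  have "(\<lambda>k. \<Sum>i\<in>UNIV. l (r k) $ i *\<^sub>R gq i (z (r k))) \<longlonglongrightarrow> (\<Sum>i\<in>UNIV. lam $ i *\<^sub>R gq i x)"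
    by (intro tendsto_intros lr isCont_tendsto_compose[OF gq_continuous zr(1)])
  moreover have "(\<Sum>i\<in>UNIV. l (r k) $ i *\<^sub>R gq i (z (r k))) = zs (r k)" for k
    using l(1)[of "r k"] by (simp add: multipliers_def)
  ultimately have "(\<Sum>i\<in>UNIV. lam $ i *\<^sub>R gq i x) = xs"
    using zr(2) LIMSEQ_unique by auto
  moreover have "lam $ i \<ge> 0 \<and> lam $ i * q i x = 0" if i: "i \<in> I" for i
  proof
    have "(\<lambda>k. l (r k) $ i) \<longlonglongrightarrow> lam $ i"
      by (intro tendsto_intros lr)
    then show "lam $ i \<ge> 0"
      by (rule LIMSEQ_le_const) (use l(1) i in \<open>auto simp: multipliers_def\<close>)
    have "(\<lambda>k. l (r k) $ i * q i (z (r k))) \<longlonglongrightarrow> lam $ i * q i x"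
      by (intro tendsto_intros lr isCont_tendsto_compose[OF q_continuous zr(1)])
    moreover have "l (r k) $ i * q i (z (r k)) = 0" for k
      using l(1)[of "r k"] i by (simp add: multipliers_def)
    ultimately show "lam $ i * q i x = 0"
      by (simp add: LIMSEQ_const_iff)
  qed
  ultimately have "lam \<in> multipliers q gq I x xs"
    by (simp add: multipliers_def)
  then show thesis
    using that[of lam r "\<lambda>k. l (r k)"] r(1) lr l(1) by blast
qed

lemma eventually_in_U:
  assumes "z \<longlonglongrightarrow> x" "x \<in> U"
  obtains N where "\<And>k. k \<ge> N \<Longrightarrow> z k \<in> U"
  using topological_tendstoD[OF assms(1) U assms(2)] unfolding eventually_sequentially by blast

lemma normal_cone_Gamma_iff:
  assumes x: "x \<in> U" "x \<in> Gamma q E I"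
  shows "xs \<in> normal_cone (Gamma q E I) x \<longleftrightarrow> multipliers q gq I x xs \<noteq> {}"
proof
  assume "xs \<in> normal_cone (Gamma q E I) x"
  then obtain z zs where z: "\<And>k. z k \<in> Gamma q E I" "z \<longlonglongrightarrow> x"
    and zs: "\<And>k. zs k \<in> regular_normal_cone (Gamma q E I) (z k)" "zs \<longlonglongrightarrow> xs"
    unfolding normal_cone_def by auto
  obtain N where N: "\<And>k. k \<ge> N \<Longrightarrow> z k \<in> U"
    using eventually_in_U[OF z(2) x(1)] by blast
  obtain lam l r where "lam \<in> multipliers q gq I x xs" "strict_mono r" "l \<longlonglongrightarrow> lam"
    "\<And>k. l k \<in> multipliers q gq I (z (r k + N)) (zs (r k + N))"
  proof (rule multipliers_limit[OF x, of "\<lambda>k. z (k + N)" "\<lambda>k. zs (k + N)" xs])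
    show "multipliers q gq I (z (k + N)) (zs (k + N)) \<noteq> {}" for k
      using regular_normal_multipliers[OF N z(1) zs(1)] by simp
  qed (use z zs N in \<open>auto simp: LIMSEQ_ignore_initial_segment\<close>)
  then show "multipliers q gq I x xs \<noteq> {}" by blast
next
  assume "multipliers q gq I x xs \<noteq> {}"
  then show "xs \<in> normal_cone (Gamma q E I) x"
    using multipliers_normal[OF x(2)] by blast
qed

end

subsection \<open>Tangents to the graph of the normal cone\<close>

context rcrcq_neighbourhood
begin

text \<open>Let \<open>y\<close> be a projection of \<open>u\<close>,
  \<open>s = norm (u - y)\<close> and \<open>D\<close> the distance of \<open>qvec q u\<close> to
  \<open>Theta E I\<close>. A multiplier for \<open>u - y\<close> of size at most
  \<open>\<gamma> * s\<close> gives \<open>s * s \<le> \<gamma> * s * D + s * s / 2\<close>, a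
  residual plus a linearization error. Absorbing the error doubles the constant.\<close>

lemma metric_subregularity:
  assumes xb: "xb \<in> U" "xb \<in> Gamma q E I"
  obtains W where "open W" "xb \<in> W"
    "\<And>u. u \<in> W \<Longrightarrow> infdist u (Gamma q E I) \<le> 2 * \<gamma> * infdist (qvec q u) (Theta E I)"
proof -
  \<comment> \<open>Chosen so that \<open>CARD('m)\<close> linearization errors of size
    \<open>\<gamma> * s * (2 * e * s)\<close> add up to \<open>s * s / 2\<close>.\<close>
  define e where "e = 1 / (4 * real CARD('m) * \<gamma>)"
  have e: "e > 0" using \<gamma> by (simp add: e_def)
  have "\<forall>\<^sub>F y in nhds xb. \<forall>i\<in>UNIV. norm (gq i y - gq i xb) < e"
  proof (intro eventually_ball_finite ballI finite)
    fix i
    have "(gq i \<longlongrightarrow> gq i xb) (nhds xb)"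
      using gq_continuous[of xb i] by (simp add: isCont_def tendsto_nhds_iff)
    then show "\<forall>\<^sub>F y in nhds xb. norm (gq i y - gq i xb) < e"
      using e by (simp add: tendsto_iff dist_norm)
  qed
  moreover have "\<forall>\<^sub>F y in nhds xb. y \<in> U"
    using U xb by (simp add: eventually_nhds_in_open)
  ultimately have "\<forall>\<^sub>F y in nhds xb. y \<in> U \<and> (\<forall>i. norm (gq i y - gq i xb) < e)"
    by eventually_elim simp
  then obtain r where r: "r > 0" and near: "\<And>y. y \<in> ball xb r \<Longrightarrow> y \<in> U"
    "\<And>y i. y \<in> ball xb r \<Longrightarrow> norm (gq i y - gq i xb) < e"
    unfolding eventually_nhds_metric by (auto simp: dist_commute)
  \<comment> \<open>One \<open>e\<close> comes from the mean value inequality for \<open>q i\<close>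
    minus its linear part at \<open>xb\<close>, the other from exchanging the gradient at
    \<open>xb\<close> for that at \<open>y\<close>.\<close>
  have taylor: "\<bar>q i u - q i y - inner (gq i y) (u - y)\<bar> \<le> 2 * e * norm (u - y)"
    if uy: "u \<in> ball xb r" "y \<in> ball xb r" for u y i
  proof -
    have "norm ((q i u - inner (gq i xb) u) - (q i y - inner (gq i xb) y)) \<le> e * norm (u - y)"
    proof (rule differentiable_bound[OF convex_ball[of xb r]])
      fix z assume z: "z \<in> ball xb r"
      have "((\<lambda>v. q i v - inner (gq i xb) v) has_derivative (\<lambda>h. inner (gq i z) h - inner (gq i xb) h)) (at z)"
        by (intro derivative_intros grad)
      then show "((\<lambda>v. q i v - inner (gq i xb) v) has_derivative (\<lambda>h. inner (gq i z - gq i xb) h)) (at z within ball xb r)"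
        by (simp add: inner_diff_left has_derivative_at_withinI)
      show "onorm (inner (gq i z - gq i xb)) \<le> e"
      proof (rule onorm_bound)
        fix h show "norm (inner (gq i z - gq i xb) h) \<le> e * norm h"
          using near(2)[OF z, of i] Cauchy_Schwarz_ineq2[of "gq i z - gq i xb" h]
          by (smt (verit) mult_right_mono norm_ge_zero real_norm_def)
      qed (use e in simp)
    qed (use uy in auto)
    moreover have "\<bar>inner (gq i y - gq i xb) (u - y)\<bar> \<le> e * norm (u - y)"
      using near(2)[OF uy(2), of i] Cauchy_Schwarz_ineq2[of "gq i y - gq i xb" "u - y"]
      by (smt (verit) mult_right_mono norm_ge_zero)
    ultimately show ?thesis
      by (simp add: inner_diff_left inner_diff_right abs_le_iff algebra_simps)
  qed
  have ThetaI: "closed (Theta E I)" "(0::real^'m) \<in> Theta E I"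
  proof -
    have "Theta E I = (\<Inter>i\<in>E. {y::real^'m. y $ i = 0}) \<inter> (\<Inter>i\<in>I. {y. y $ i \<le> 0})"
      by (auto simp: Theta_def)
    then show "closed (Theta E I :: (real^'m) set)"
      by (auto intro!: closed_Int closed_INT closed_Collect_eq closed_Collect_le continuous_intros)
  qed (simp add: Theta_def)
  show thesis
  \<comment> \<open>Half the radius keeps \<open>y\<close> in the larger ball: \<open>xb\<close> is
    feasible, so \<open>y\<close> is at least as close to \<open>u\<close> as \<open>xb\<close>
    is.\<close>
  proof (rule that[of "ball xb (r/2)"])
    fix u assume u: "u \<in> ball xb (r/2)"
    obtain y where y: "y \<in> Gamma q E I" "infdist u (Gamma q E I) = dist u y"
      using infdist_attains_inf[OF closed_Gamma] xb by blast
    have least: "dist u y \<le> dist u v" if "v \<in> Gamma q E I" for v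
      using infdist_le[OF that, of u] y(2) by simp
    have "dist u y < r/2"
      using least[OF xb(2)] u by (simp add: dist_commute)
    then have yr: "y \<in> ball xb r" "u \<in> ball xb r"
      using u r dist_triangle[of xb y u] by auto
    \<comment> \<open>Expanding squared distances, minimality of \<open>y\<close> gives
      \<open>inner (u - y) (v - y) \<le> (norm (v - y))\<^sup>2 / 2\<close>, which is at most
      \<open>c * norm (v - y)\<close> once \<open>norm (v - y) < 2 * c\<close>.\<close>
    have "u - y \<in> regular_normal_cone (Gamma q E I) y"
      unfolding mem_regular_normal_cone_iff eventually_at_filter eventually_nhds_metric
    proof (intro allI impI)
      fix c :: real assume c: "c > 0"
      have "inner (u - y) (v - y) \<le> c * norm (v - y)" if v: "dist v y < 2 * c" "v \<in> Gamma q E I" for v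
      proof -
        have "(norm (u - y))\<^sup>2 \<le> (norm (u - v))\<^sup>2"
          using least[OF v(2)] by (intro power_mono) (auto simp: dist_norm)
        also have "(norm (u - v))\<^sup>2 = (norm (u - y))\<^sup>2 - 2 * inner (u - y) (v - y) + (norm (v - y))\<^sup>2"
          using dot_norm_neg[of "u - y" "v - y"] by (simp add: field_simps)
        finally have "2 * inner (u - y) (v - y) \<le> norm (v - y) * norm (v - y)"
          by (simp add: power2_eq_square)
        also have "\<dots> \<le> 2 * c * norm (v - y)"
          using v(1) by (intro mult_right_mono) (auto simp: dist_norm)
        finally show ?thesis by simp
      qed
      then show "\<exists>d>0. \<forall>v. dist v y < d \<longrightarrow> v \<noteq> y \<longrightarrow> v \<in> Gamma q E I \<longrightarrow> inner (u - y) (v - y) \<le> c * norm (v - y)"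
        using c by (intro exI[of _ "2 * c"]) auto
    qed
    then have "multipliers q gq I y (u - y) \<noteq> {}"
      using regular_normal_multipliers[OF near(1)[OF yr(1)] y(1)] by blast
    then obtain lam where lam: "lam \<in> multipliers q gq I y (u - y)" "norm lam \<le> \<gamma> * norm (u - y)"
      using bounded[OF near(1)[OF yr(1)] y(1)] by blast
    define s where "s = norm (u - y)"
    define D where "D = infdist (qvec q u) (Theta E I)"
    \<comment> \<open>A nearest point of \<open>Theta E I\<close> to \<open>qvec q u\<close>. Its
      pairing with \<open>lam\<close> is nonpositive, so subtracting it from \<open>qvec q u\<close>
      bounds the residual by \<open>norm lam * D\<close>, although \<open>lam\<close> is sign-free
      on \<open>E\<close>.\<close>
    obtain \<theta> where \<theta>: "\<theta> \<in> Theta E I" "D = norm (qvec q u - \<theta>)"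
      using infdist_attains_inf[OF ThetaI(1), of "qvec q u"] ThetaI(2) unfolding D_def dist_norm by blast
    have "lam $ i * \<theta> $ i \<le> 0" for i
      using E_or_I[of i] \<theta>(1) lam(1) by (auto simp: Theta_def multipliers_def mult_nonneg_nonpos)
    then have "inner lam \<theta> \<le> 0"
      by (simp add: inner_vec_def sum_nonpos)
    moreover have "inner lam (qvec q u - \<theta>) \<le> norm lam * D"
      unfolding \<theta>(2) by (rule norm_cauchy_schwarz)
    moreover have "norm lam * D \<le> \<gamma> * s * D"
      using lam(2) by (intro mult_right_mono) (auto simp: s_def D_def infdist_nonneg)
    ultimately have "inner lam (qvec q u) \<le> \<gamma> * s * D"
      by (simp add: inner_diff_right)
    then have sum_le: "(\<Sum>i\<in>UNIV. lam $ i * q i u) \<le> \<gamma> * s * D"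
      by (simp add: inner_vec_def qvec_def)
    have term_le: "lam $ i * inner (gq i y) (u - y) \<le> lam $ i * q i u + \<gamma> * s * (2 * e * s)" for i
    proof -
      have "lam $ i * q i y = 0"
        using E_or_I[of i] y(1) lam(1) by (auto simp: mem_Gamma_iff multipliers_def)
      then have "lam $ i * inner (gq i y) (u - y) - lam $ i * q i u =
          - (lam $ i * (q i u - q i y - inner (gq i y) (u - y)))"
        by (simp add: algebra_simps)
      also have "\<dots> \<le> \<bar>lam $ i\<bar> * \<bar>q i u - q i y - inner (gq i y) (u - y)\<bar>"
        by (metis abs_ge_minus_self abs_mult)
      also have "\<dots> \<le> (\<gamma> * s) * (2 * e * s)"
        using taylor[OF yr(2,1), of i] component_le_norm_cart[of lam i] lam(2) \<gamma>
        by (intro mult_mono) (auto simp: s_def)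
      finally show ?thesis by simp
    qed
    have "s * s = inner (u - y) (u - y)"
      by (simp add: s_def dot_square_norm power2_eq_square)
    also have "\<dots> = inner (\<Sum>i\<in>UNIV. lam $ i *\<^sub>R gq i y) (u - y)"
      using lam(1) by (simp add: multipliers_def)
    also have "\<dots> = (\<Sum>i\<in>UNIV. lam $ i * inner (gq i y) (u - y))"
      by (simp add: inner_sum_left)
    also have "\<dots> \<le> (\<Sum>i\<in>UNIV. lam $ i * q i u + \<gamma> * s * (2 * e * s))"
      by (intro sum_mono term_le)
    also have "\<dots> \<le> \<gamma> * s * D + real CARD('m) * (\<gamma> * s * (2 * e * s))"
      using sum_le by (simp add: sum.distrib)
    also have "real CARD('m) * (\<gamma> * s * (2 * e * s)) = s * s / 2"
      using \<gamma> by (simp add: e_def)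
    finally have "s * s \<le> (2 * \<gamma> * D) * s"
      by (simp add: field_simps)
    moreover have "s \<ge> 0" "2 * \<gamma> * D \<ge> 0"
      using \<gamma> by (auto simp: s_def D_def infdist_nonneg)
    ultimately have "s \<le> 2 * \<gamma> * D"
      by (cases "s = 0") (auto simp: mult_le_cancel_right)
    then show "infdist u (Gamma q E I) \<le> 2 * \<gamma> * infdist (qvec q u) (Theta E I)"
      using y(2) by (simp add: s_def D_def dist_norm)
  qed (use r in auto)
qed

text \<open>On the linearized cone every summand of \<open>inner xs u\<close> is nonpositive, so the
  sum vanishes exactly when each summand does. The description uses a single multiplier while the
  cone does not depend on it.\<close>

lemma mem_critical_cone_iff:
  assumes x: "x \<in> U" "x \<in> Gamma q E I" and lam: "lam \<in> multipliers q gq I x xs"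
  shows "u \<in> critical_cone q E I x xs \<longleftrightarrow>
    (\<forall>i\<in>E \<union> Iplus_lam I lam. inner (gq i x) u = 0) \<and> (\<forall>i\<in>active_set q I x. inner (gq i x) u \<le> 0)"
    (is "_ \<longleftrightarrow> ?R")
proof -
  have xs: "inner xs u = (\<Sum>i\<in>UNIV. lam $ i * inner (gq i x) u)"
    using lam by (auto simp: multipliers_def inner_sum_left)
  have mem: "u \<in> critical_cone q E I x xs \<longleftrightarrow> u \<in> linearized_cone x \<and> inner xs u = 0"
    by (simp add: critical_cone_def tangent_cone_Gamma[OF x])
  show ?thesis
  proof
    assume u: "u \<in> critical_cone q E I x xs"
    then have lin: "u \<in> linearized_cone x" and 0: "inner xs u = 0"
      using mem by auto
    have nonpos: "lam $ i * inner (gq i x) u \<le> 0" for i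
    proof (cases "lam $ i = 0 \<or> i \<in> E")
      case False
      then have "i \<in> active_set q I x" "lam $ i > 0"
        using multipliers_active[OF lam] E_or_I by blast+
      then show ?thesis
        using lin by (simp add: linearized_cone_def mult_nonneg_nonpos)
    qed (use lin in \<open>auto simp: linearized_cone_def\<close>)
    have "lam $ i * inner (gq i x) u = 0" for i
      using 0 xs by (intro sum_nonpos_eq_0_imp[OF nonpos]) simp
    then show ?R
      using lin by (force simp: linearized_cone_def Iplus_lam_def)
  next
    assume R: ?R
    have "lam $ i * inner (gq i x) u = 0" for i
      using R E_or_I[of i] multipliers_active(2)[OF lam, of i]
      by (cases "lam $ i = 0") (auto simp: Iplus_lam_def)
    then have "inner xs u = 0"
      unfolding xs by (intro sum.neutral) auto
    then show "u \<in> critical_cone q E I x xs"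
      using R by (simp add: mem linearized_cone_def)
  qed
qed

text \<open>The previous description applies with whichever multiplier is positive at
  \<open>i\<close>, because the cone is the same for all of them.\<close>

lemma critical_cone_Iplus:
  assumes x: "x \<in> U" "x \<in> Gamma q E I" and u: "u \<in> critical_cone q E I x xs"
    and i: "i \<in> Iplus q gq I x xs"
  shows "inner (gq i x) u = 0"
  using i u mem_critical_cone_iff[OF x] by (auto simp: Iplus_def)

lemma normal_cone_critical_cone:
  assumes x: "x \<in> U" "x \<in> Gamma q E I" and lam: "lam \<in> multipliers q gq I x xs"
  shows "n \<in> normal_cone (critical_cone q E I x xs) w \<longleftrightarrow>
    w \<in> critical_cone q E I x xs \<and> inner n w = 0 \<and> (\<forall>u\<in>critical_cone q E I x xs. inner n u \<le> 0)"
proof -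
  have "convex_cone (critical_cone q E I x xs)"
    unfolding convex_cone_iff
    by (auto simp: mem_critical_cone_iff[OF x lam] inner_add_right mult_nonneg_nonpos intro: add_nonpos_nonpos)
  then show ?thesis by (simp add: normal_cone_convex_cone)
qed

text \<open>The difference of two multipliers is a dependence among gradients indexed by
  \<open>E\<close> and \<open>Iplus\<close>, a family of constant rank since \<open>Iplus\<close>
  consists of active indices. With \<open>w = u = v\<close> this makes the quadratic form constant
  on the multiplier set; with \<open>u\<close> critical it allows multipliers to be
  exchanged.\<close>

lemma hess_lag_multiplier_independent:
  assumes x: "x \<in> U" "x \<in> Gamma q E I"
    and lam: "lam \<in> multipliers q gq I x xs" and mu: "mu \<in> multipliers q gq I x xs"
    and u: "\<And>i. i \<in> E \<union> Iplus q gq I x xs \<Longrightarrow> inner (gq i x) u = 0"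
  shows "inner (hess_lag hq lam x *v w) u = inner (hess_lag hq mu x *v w) u"
proof -
  have "(lam - mu) $ i = 0" if "i \<notin> E \<union> Iplus q gq I x xs" for i
  proof -
    have "nu $ i = 0" if "nu \<in> multipliers q gq I x xs" for nu
      using that \<open>i \<notin> E \<union> Iplus q gq I x xs\<close> E_or_I[of i] multipliers_active(2)[of nu q gq I x xs i]
      by (auto simp: Iplus_def Iplus_lam_def)
    then show ?thesis using lam mu by simp
  qed
  moreover have "(\<Sum>i\<in>UNIV. (lam - mu) $ i *\<^sub>R gq i x) = 0"
    using lam mu by (simp add: multipliers_def scaleR_diff_left sum_subtractf)
  ultimately have "inner (\<Sum>i\<in>UNIV. (lam - mu) $ i *\<^sub>R (hq i x *v w)) u = 0"
    using constant_rank_derivative_dependence[of U x gq "E \<union> Iplus q gq I x xs" "\<lambda>i h. hq i x *v h" "lam - mu" u w]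
      U x rank[OF x Iplus_subset_active] hess u by blast
  then show ?thesis
    by (simp add: hess_lag_mult scaleR_diff_left sum_subtractf inner_diff_left)
qed

text \<open>Membership in the normal cone of the critical cone is tested only by pairings with
  critical directions, and there the two Hessian terms agree.\<close>

lemma normal_shift_multiplier_independent:
  assumes x: "x \<in> U" "x \<in> Gamma q E I"
    and lam: "lam \<in> multipliers q gq I x xs" and mu: "mu \<in> multipliers q gq I x xs"
    and z: "z - hess_lag hq mu x *v w \<in> normal_cone (critical_cone q E I x xs) w"
  shows "z - hess_lag hq lam x *v w \<in> normal_cone (critical_cone q E I x xs) w"
proof -
  have "inner (z - hess_lag hq lam x *v w) u = inner (z - hess_lag hq mu x *v w) u"
    if "u \<in> critical_cone q E I x xs" for u
    unfolding inner_diff_left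
    using hess_lag_multiplier_independent[OF x lam mu, of u w] critical_cone_Iplus[OF x that]
      mem_critical_cone_iff[OF x lam, of u] that by auto
  then show ?thesis
    using z by (auto simp: normal_cone_critical_cone[OF x lam])
qed

text \<open>Removing the curvature term from \<open>z\<close> leaves the limit of
  \<open>D k\<close>, a combination of gradients at the fixed point \<open>x\<close>. Signs and
  supports of its coefficients give the polar inequality and the orthogonality to
  \<open>w\<close>.\<close>

lemma tangent_graph_imp_normal:
  assumes x: "x \<in> U" "x \<in> Gamma q E I"
    and wz: "(w, z) \<in> tangent_cone (graph (normal_cone (Gamma q E I))) (x, xs)"
  obtains lam where "lam \<in> multipliers q gq I x xs"
    "z - hess_lag hq lam x *v w \<in> normal_cone (critical_cone q E I x xs) w"
proof -
  obtain t0 p where t0: "\<And>k. t0 k > (0::real)" "t0 \<longlonglongrightarrow> 0" and p: "p \<longlonglongrightarrow> (w, z)"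
    and mem: "\<And>k. (x, xs) + t0 k *\<^sub>R p k \<in> graph (normal_cone (Gamma q E I))"
    using wz unfolding tangent_cone_def by auto
  define y0 where "y0 k = x + t0 k *\<^sub>R fst (p k)" for k
  define ys0 where "ys0 k = xs + t0 k *\<^sub>R snd (p k)" for k
  have normal: "ys0 k \<in> normal_cone (Gamma q E I) (y0 k)" for k
    using mem[of k] by (cases "p k") (simp add: graph_def y0_def ys0_def)
  have fp: "(\<lambda>k. fst (p k)) \<longlonglongrightarrow> w" "(\<lambda>k. snd (p k)) \<longlonglongrightarrow> z"
    using tendsto_fst[OF p] tendsto_snd[OF p] by simp_all
  have "y0 \<longlonglongrightarrow> x + 0 *\<^sub>R w" "ys0 \<longlonglongrightarrow> xs + 0 *\<^sub>R z"
    unfolding y0_def ys0_def by (intro tendsto_intros t0 fp)+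
  then have lim0: "y0 \<longlonglongrightarrow> x" "ys0 \<longlonglongrightarrow> xs" by simp_all
  have y0\<Gamma>: "y0 k \<in> Gamma q E I" for k
    using normal[of k] by (simp add: normal_cone_def)
  obtain N where N: "\<And>k. k \<ge> N \<Longrightarrow> y0 k \<in> U"
    using eventually_in_U[OF lim0(1) x(1)] by blast
  obtain lam l r where lam: "lam \<in> multipliers q gq I x xs" and r: "strict_mono r" and l: "l \<longlonglongrightarrow> lam"
    "\<And>k. l k \<in> multipliers q gq I (y0 (r k + N)) (ys0 (r k + N))"
  proof (rule multipliers_limit[OF x, of "\<lambda>k. y0 (k + N)" "\<lambda>k. ys0 (k + N)" xs])
    show "multipliers q gq I (y0 (k + N)) (ys0 (k + N)) \<noteq> {}" for k
      by (rule normal_cone_Gamma_iff[THEN iffD1, OF N y0\<Gamma> normal]) simp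
    show "(\<lambda>k. y0 (k + N)) \<longlonglongrightarrow> x" "(\<lambda>k. ys0 (k + N)) \<longlonglongrightarrow> xs"
      using lim0 by (simp_all add: LIMSEQ_ignore_initial_segment)
  qed (use y0\<Gamma> N in auto)
  define \<rho> where "\<rho> k = r k + N" for k
  have "strict_mono \<rho>"
    using r by (simp add: \<rho>_def strict_mono_def)
  define t where "t k = t0 (\<rho> k)" for k
  define v where "v k = fst (p (\<rho> k))" for k
  define y where "y k = x + t k *\<^sub>R v k" for k
  have t: "\<And>k. t k > 0" "t \<longlonglongrightarrow> 0"
    using t0 LIMSEQ_subseq_LIMSEQ[OF t0(2) \<open>strict_mono \<rho>\<close>] unfolding t_def o_def by simp_all
  have v: "v \<longlonglongrightarrow> w"
    using LIMSEQ_subseq_LIMSEQ[OF fp(1) \<open>strict_mono \<rho>\<close>] unfolding v_def o_def by simp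
  have Z: "(\<lambda>k. snd (p (\<rho> k))) \<longlonglongrightarrow> z"
    using LIMSEQ_subseq_LIMSEQ[OF fp(2) \<open>strict_mono \<rho>\<close>] by (simp add: o_def)
  have y: "y \<longlonglongrightarrow> x" "\<And>k. y k \<in> Gamma q E I"
    using LIMSEQ_subseq_LIMSEQ[OF lim0(1) \<open>strict_mono \<rho>\<close>] y0\<Gamma>
    unfolding y_def t_def v_def y0_def o_def by simp_all
  have ly: "l k \<in> multipliers q gq I (y k) (xs + t k *\<^sub>R snd (p (\<rho> k)))" for k
    using l(2)[of k] by (simp add: y_def t_def v_def y0_def ys0_def \<rho>_def)
  have wlin: "w \<in> linearized_cone x"
  proof -
    have "w \<in> tangent_cone (Gamma q E I) x"
      unfolding tangent_cone_def mem_Collect_eq using t v y(2)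
      by (intro exI[of _ t] exI[of _ v]) (auto simp: y_def)
    then show ?thesis by (simp add: tangent_cone_Gamma[OF x])
  qed
  \<comment> \<open>Such a constraint is strictly negative at \<open>y k\<close> for large
    \<open>k\<close>, either by continuity or by its slope along \<open>w\<close>; complementarity
    then removes its multiplier, also in the limit.\<close>
  have vanish: "(\<forall>\<^sub>F k in sequentially. l k $ i = 0) \<and> lam $ i = 0"
    if i: "i \<in> I" "q i x < 0 \<or> inner (gq i x) w < 0" for i
  proof -
    have "\<forall>\<^sub>F k in sequentially. q i (y k) < 0"
    proof (cases "q i x < 0")
      case True
      then show ?thesis
        using isCont_tendsto_compose[OF q_continuous[of x i] y(1)] by (intro order_tendstoD(2))
    next
      case False
      then have neg: "inner (gq i x) w < 0" and qx: "q i x = 0"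
        using i x(2) by (auto simp: mem_Gamma_iff intro: antisym)
      have "\<forall>\<^sub>F k in sequentially. (q i (y k) - q i x) /\<^sub>R t k < 0"
        using has_derivative_along_sequence[OF grad t v, of i x] neg unfolding y_def
        by (intro order_tendstoD(2))
      then show ?thesis
      proof eventually_elim
        case (elim k)
        then show ?case using t(1)[of k] qx by (simp add: mult_less_0_iff)
      qed
    qed
    then have ev: "\<forall>\<^sub>F k in sequentially. l k $ i = 0"
    proof eventually_elim
      case (elim k)
      then show ?case using ly[of k] i(1) by (auto simp: multipliers_def)
    qed
    have "(\<lambda>k. l k $ i) \<longlonglongrightarrow> lam $ i"
      by (intro tendsto_intros l)
    then have "lam $ i = 0"
      using LIMSEQ_unique[OF _ tendsto_eventually[OF ev]] by simp
    with ev show ?thesis by blast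
  qed
  have wK: "w \<in> critical_cone q E I x xs"
    unfolding mem_critical_cone_iff[OF x lam]
  proof (intro conjI ballI)
    fix i assume i: "i \<in> E \<union> Iplus_lam I lam"
    show "inner (gq i x) w = 0"
    proof (cases "i \<in> E")
      case False
      then have "i \<in> I" "lam $ i > 0" using i by (auto simp: Iplus_lam_def)
      moreover have "inner (gq i x) w \<le> 0"
        using wlin multipliers_active(1)[OF lam \<open>i \<in> I\<close>] \<open>lam $ i > 0\<close> by (simp add: linearized_cone_def)
      ultimately show ?thesis
        using vanish[of i] by force
    qed (use wlin in \<open>simp add: linearized_cone_def\<close>)
  qed (use wlin in \<open>simp add: linearized_cone_def\<close>)
  \<comment> \<open>Only this combination is shown to converge; nothing is claimed about the
    individual quotients \<open>(l k $ i - lam $ i) / t k\<close>.\<close>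
  define D where "D k = (\<Sum>i\<in>UNIV. ((l k $ i - lam $ i) / t k) *\<^sub>R gq i x)" for k
  define n where "n = z - hess_lag hq lam x *v w"
  have "D \<longlonglongrightarrow> n"
  proof -
    have lim: "(\<lambda>k. snd (p (\<rho> k)) - (\<Sum>i\<in>UNIV. l k $ i *\<^sub>R ((gq i (y k) - gq i x) /\<^sub>R t k)))
        \<longlonglongrightarrow> z - (\<Sum>i\<in>UNIV. lam $ i *\<^sub>R (hq i x *v w))"
      unfolding y_def by (intro tendsto_intros Z l has_derivative_along_sequence[OF hess t v])
    have eq: "snd (p (\<rho> k)) - (\<Sum>i\<in>UNIV. l k $ i *\<^sub>R ((gq i (y k) - gq i x) /\<^sub>R t k)) = D k" for k
    proof -
      have "t k *\<^sub>R snd (p (\<rho> k)) = (\<Sum>i\<in>UNIV. l k $ i *\<^sub>R gq i (y k)) - (\<Sum>i\<in>UNIV. lam $ i *\<^sub>R gq i x)"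
        using ly[of k] lam by (simp add: multipliers_def)
      moreover have "snd (p (\<rho> k)) = inverse (t k) *\<^sub>R (t k *\<^sub>R snd (p (\<rho> k)))"
        using t(1)[of k] by simp
      ultimately have "snd (p (\<rho> k)) = inverse (t k) *\<^sub>R
          ((\<Sum>i\<in>UNIV. l k $ i *\<^sub>R gq i (y k)) - (\<Sum>i\<in>UNIV. lam $ i *\<^sub>R gq i x))"
        by presburger
      then show ?thesis
        by (simp add: D_def scaleR_diff_right scaleR_diff_left sum_subtractf scaleR_sum_right
            right_diff_distrib divide_inverse mult.commute)
    qed
    show ?thesis
      using lim unfolding eq n_def hess_lag_mult .
  qed
  have D_inner: "inner (D k) u = (\<Sum>i\<in>UNIV. (l k $ i - lam $ i) * inner (gq i x) u / t k)" for k u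
    by (simp add: D_def inner_sum_left)
  have "inner n u \<le> 0" if u: "u \<in> critical_cone q E I x xs" for u
  proof -
    \<comment> \<open>A nonzero pairing with a critical \<open>u\<close> forces
      \<open>lam $ i = 0\<close>. Then either the index is active and a nonnegative
      \<open>l k $ i\<close> meets a nonpositive slope, or it is inactive and \<open>l k $ i\<close>
      vanishes eventually.\<close>
    have "\<forall>\<^sub>F k in sequentially. (l k $ i - lam $ i) * inner (gq i x) u \<le> 0" for i
    proof (cases "inner (gq i x) u = 0")
      case False
      then have "i \<notin> E" "i \<notin> Iplus_lam I lam"
        using u mem_critical_cone_iff[OF x lam] by auto
      then have i: "i \<in> I" "lam $ i = 0"
        using E_or_I multipliers_active(2)[OF lam] by (auto simp: Iplus_lam_def)
      show ?thesis
      proof (cases "i \<in> active_set q I x")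
        case True
        then have "inner (gq i x) u \<le> 0"
          using u mem_critical_cone_iff[OF x lam] by auto
        moreover have "l k $ i \<ge> 0" for k
          using ly[of k] i(1) by (simp add: multipliers_def)
        ultimately show ?thesis
          using i(2) by (simp add: mult_nonneg_nonpos)
      next
        case False
        then have "q i x < 0"
          using i x(2) by (force simp: active_set_def mem_Gamma_iff)
        then show ?thesis
          using vanish[OF i(1)] i(2) by (auto elim: eventually_mono)
      qed
    qed simp
    then have "\<forall>\<^sub>F k in sequentially. \<forall>i\<in>UNIV. (l k $ i - lam $ i) * inner (gq i x) u \<le> 0"
      by (intro eventually_ball_finite) auto
    then have "\<forall>\<^sub>F k in sequentially. inner (D k) u \<le> 0"
    proof eventually_elim
      case (elim k)
      then show ?case
        unfolding D_inner using t(1)[of k] by (intro sum_nonpos) (simp add: divide_nonpos_pos)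
    qed
    moreover have "(\<lambda>k. inner (D k) u) \<longlonglongrightarrow> inner n u"
      by (intro tendsto_intros \<open>D \<longlonglongrightarrow> n\<close>)
    ultimately show ?thesis
      by (intro tendsto_upperbound[of _ _ sequentially]) auto
  qed
  moreover have "inner n w = 0"
  proof -
    have "\<forall>\<^sub>F k in sequentially. (l k $ i - lam $ i) * inner (gq i x) w = 0" for i
    proof (cases "inner (gq i x) w = 0")
      case False
      then have i: "i \<in> I"
        using wlin E_or_I[of i] by (auto simp: linearized_cone_def)
      have "q i x < 0 \<or> inner (gq i x) w < 0"
        using False i wlin x(2) by (force simp: linearized_cone_def mem_Gamma_iff active_set_def)
      then show ?thesis
        using vanish[OF i] by (auto elim: eventually_mono)
    qed simp
    then have "\<forall>\<^sub>F k in sequentially. \<forall>i\<in>UNIV. (l k $ i - lam $ i) * inner (gq i x) w = 0"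
      by (intro eventually_ball_finite) auto
    then have ev: "\<forall>\<^sub>F k in sequentially. inner (D k) w = 0"
      by eventually_elim (auto simp: D_inner intro!: sum.neutral)
    have "(\<lambda>k. inner (D k) w) \<longlonglongrightarrow> inner n w"
      by (intro tendsto_intros \<open>D \<longlonglongrightarrow> n\<close>)
    then show ?thesis
      using LIMSEQ_unique[OF _ tendsto_eventually[OF ev]] by simp
  qed
  ultimately have "n \<in> normal_cone (critical_cone q E I x xs) w"
    using wK by (simp add: normal_cone_critical_cone[OF x lam])
  then show thesis
    using that[OF lam] by (simp add: n_def)
qed

text \<open>Farkas' lemma writes \<open>n\<close> with coefficients \<open>\<nu>\<close>, sign-free
  on \<open>E\<close> and where \<open>lam\<close> is positive. Perturbing \<open>lam\<close> by
  \<open>t k *\<^sub>R \<nu>\<close> along a feasible sequence that keeps the constraints in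
  \<open>J\<close> at zero gives genuine normals; the moving gradients contribute the Hessian term,
  and \<open>\<nu>\<close> contributes \<open>n\<close>.\<close>

lemma normal_imp_tangent_graph:
  assumes x: "x \<in> U" "x \<in> Gamma q E I" and lam: "lam \<in> multipliers q gq I x xs"
    and n: "n \<in> normal_cone (critical_cone q E I x xs) w"
  shows "(w, hess_lag hq lam x *v w + n) \<in> tangent_cone (graph (normal_cone (Gamma q E I))) (x, xs)"
proof -
  define P where "P = E \<union> Iplus_lam I lam"
  define N where "N = active_set q I x - P"
  have wK: "w \<in> critical_cone q E I x xs" and nw: "inner n w = 0"
    and le: "\<And>u. u \<in> critical_cone q E I x xs \<Longrightarrow> inner n u \<le> 0"
    using n normal_cone_critical_cone[OF x lam] by auto
  have w: "\<And>i. i \<in> P \<Longrightarrow> inner (gq i x) w = 0" "\<And>i. i \<in> active_set q I x \<Longrightarrow> inner (gq i x) w \<le> 0"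
    using wK mem_critical_cone_iff[OF x lam] by (auto simp: P_def)
  have disj: "P \<inter> N = {}" by (auto simp: N_def)
  have polar: "inner n u \<le> 0" if "\<And>i. i \<in> P \<Longrightarrow> inner (gq i x) u = 0"
    "\<And>i. i \<in> N \<Longrightarrow> inner (gq i x) u \<le> 0" for u
  proof (rule le)
    show "u \<in> critical_cone q E I x xs"
      unfolding mem_critical_cone_iff[OF x lam] using that by (force simp: P_def N_def)
  qed
  obtain \<nu> :: "real^'m" where \<nu>: "n = (\<Sum>i\<in>UNIV. \<nu> $ i *\<^sub>R gq i x)"
    "\<forall>i. i \<notin> P \<union> N \<longrightarrow> \<nu> $ i = 0" "\<forall>i\<in>N. \<nu> $ i \<ge> 0"
    by (rule farkas[of P N "\<lambda>i. gq i x" n, OF disj polar])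
  \<comment> \<open>Orthogonality of \<open>n\<close> and \<open>w\<close> splits into the
    individual terms since none of them is positive; hence \<open>\<nu>\<close> lives on constraints
    with zero slope along \<open>w\<close>.\<close>
  have "\<nu> $ i * inner (gq i x) w = 0" for i
  proof -
    have "\<nu> $ i * inner (gq i x) w \<le> 0" for i
      using \<nu>(2,3) w[of i] by (cases "i \<in> P"; cases "i \<in> N") (auto simp: N_def mult_nonneg_nonpos)
    moreover have "(\<Sum>i\<in>UNIV. \<nu> $ i * inner (gq i x) w) = 0"
      using nw \<nu>(1) by (simp add: inner_sum_left)
    ultimately show ?thesis
      by (rule sum_nonpos_eq_0_imp)
  qed
  then have comp: "inner (gq i x) w = 0" if "\<nu> $ i \<noteq> 0" for i
    using that by (metis mult_eq_0_iff)
  define J where "J = {i\<in>active_set q I x. inner (gq i x) w = 0}"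
  have J: "J \<subseteq> active_set q I x" "\<And>i. i \<in> E \<union> J \<Longrightarrow> inner (gq i x) w = 0"
    "\<And>i. i \<in> active_set q I x - J \<Longrightarrow> inner (gq i x) w < 0"
    using w by (auto simp: J_def P_def order_less_le)
  obtain t u where t: "\<And>k. t k > (0::real)" "t \<longlonglongrightarrow> 0" and u: "u \<longlonglongrightarrow> w"
    and mem: "\<And>k. x + t k *\<^sub>R u k \<in> Gamma q E I"
    and zero: "\<And>k i. i \<in> E \<union> J \<Longrightarrow> q i (x + t k *\<^sub>R u k) = 0"
    using tangent_sequence[OF x J] by metis
  define y where "y k = x + t k *\<^sub>R u k" for k
  have "y \<longlonglongrightarrow> x + 0 *\<^sub>R w"
    unfolding y_def by (intro tendsto_intros t u)
  then have y: "y \<longlonglongrightarrow> x" by simp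
  define l where "l k = lam + t k *\<^sub>R \<nu>" for k
  \<comment> \<open>Among the inequalities, \<open>lam\<close> and \<open>\<nu>\<close> are
    supported on \<open>J\<close>, where the constraints vanish along the sequence; complementarity
    of \<open>l k\<close> is then exact and not merely asymptotic.\<close>
  have supp: "i \<in> J" if "i \<in> I" "lam $ i \<noteq> 0 \<or> \<nu> $ i \<noteq> 0" for i
  proof (cases "lam $ i = 0")
    case True
    then have "\<nu> $ i \<noteq> 0" using that by simp
    moreover from this have "i \<in> active_set q I x"
      using \<nu>(2) that(1) True partition by (auto simp: P_def N_def Iplus_lam_def)
    ultimately show ?thesis using comp by (simp add: J_def)
  next
    case False
    then have "i \<in> active_set q I x" "i \<in> P"
      using multipliers_active[OF lam that(1)] that(1) by (auto simp: P_def Iplus_lam_def)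
    then show ?thesis using w by (simp add: J_def)
  qed
  \<comment> \<open>Where \<open>lam $ i > 0\<close>, a small perturbation of either sign is
    harmless; elsewhere \<open>\<nu> $ i\<close> is nonnegative.\<close>
  have "\<forall>\<^sub>F k in sequentially. l k $ i \<ge> 0" if i: "i \<in> I" for i
  proof (cases "lam $ i > 0")
    case True
    have "(\<lambda>k. l k $ i) \<longlonglongrightarrow> (lam + 0 *\<^sub>R \<nu>) $ i"
      unfolding l_def by (intro tendsto_intros t)
    then have "\<forall>\<^sub>F k in sequentially. l k $ i > 0"
      using True by (intro order_tendstoD(1)) auto
    then show ?thesis by eventually_elim simp
  next
    case False
    then have "lam $ i = 0" "i \<notin> P"
      using lam i partition by (auto simp: multipliers_def P_def Iplus_lam_def intro: antisym)
    moreover have "\<nu> $ i \<ge> 0"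
      using \<nu>(2,3) \<open>i \<notin> P\<close> by (cases "i \<in> N") auto
    ultimately show ?thesis
      using t(1) by (simp add: l_def less_imp_le)
  qed
  then have "\<forall>\<^sub>F k in sequentially. \<forall>i\<in>I. l k $ i \<ge> 0"
    by (simp add: eventually_ball_finite)
  then obtain K where K: "\<And>k i. k \<ge> K \<Longrightarrow> i \<in> I \<Longrightarrow> l k $ i \<ge> 0"
    unfolding eventually_sequentially by blast
  define ys where "ys k = (\<Sum>i\<in>UNIV. l k $ i *\<^sub>R gq i (y k))" for k
  define Z where "Z k = (ys k - xs) /\<^sub>R t k" for k
  have "Z \<longlonglongrightarrow> hess_lag hq lam x *v w + n"
  proof -
    have quot: "(\<lambda>k. (gq i (y k) - gq i x) /\<^sub>R t k) \<longlonglongrightarrow> hq i x *v w" for i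
      unfolding y_def by (rule has_derivative_along_sequence[OF hess t u])
    have "(\<lambda>k. (\<Sum>i\<in>UNIV. lam $ i *\<^sub>R ((gq i (y k) - gq i x) /\<^sub>R t k)) + (\<Sum>i\<in>UNIV. \<nu> $ i *\<^sub>R gq i (y k)))
        \<longlonglongrightarrow> (\<Sum>i\<in>UNIV. lam $ i *\<^sub>R (hq i x *v w)) + (\<Sum>i\<in>UNIV. \<nu> $ i *\<^sub>R gq i x)"
      by (intro tendsto_intros isCont_tendsto_compose[OF gq_continuous y] quot)
    moreover have "(\<Sum>i\<in>UNIV. lam $ i *\<^sub>R ((gq i (y k) - gq i x) /\<^sub>R t k)) + (\<Sum>i\<in>UNIV. \<nu> $ i *\<^sub>R gq i (y k)) = Z k" for k
    proof -
      have "xs = (\<Sum>i\<in>UNIV. lam $ i *\<^sub>R gq i x)"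
        using lam by (simp add: multipliers_def)
      moreover have "lam $ i *\<^sub>R ((gq i (y k) - gq i x) /\<^sub>R t k) + \<nu> $ i *\<^sub>R gq i (y k) =
          (l k $ i *\<^sub>R gq i (y k) - lam $ i *\<^sub>R gq i x) /\<^sub>R t k" for i
        using t(1)[of k] by (simp add: l_def algebra_simps)
      ultimately show ?thesis
        by (simp add: Z_def ys_def sum.distrib[symmetric] sum_subtractf[symmetric] scaleR_sum_right)
    qed
    ultimately show ?thesis
      by (simp add: hess_lag_mult \<nu>(1))
  qed
  have graph: "(x, xs) + t (k + K) *\<^sub>R (u (k + K), Z (k + K)) \<in> graph (normal_cone (Gamma q E I))" for k
  proof -
    have "l (k + K) $ i * q i (y (k + K)) = 0" if "i \<in> I" for i
      using supp[OF that] zero[of i] by (cases "lam $ i = 0 \<and> \<nu> $ i = 0") (auto simp: l_def y_def)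
    then have "l (k + K) \<in> multipliers q gq I (y (k + K)) (ys (k + K))"
      using K[of "k + K"] by (simp add: multipliers_def ys_def)
    then have "ys (k + K) \<in> normal_cone (Gamma q E I) (y (k + K))"
      using multipliers_normal mem by (simp add: y_def)
    moreover have "xs + t (k + K) *\<^sub>R Z (k + K) = ys (k + K)"
      using t(1)[of "k + K"] by (simp add: Z_def)
    ultimately show ?thesis
      by (simp add: graph_def y_def)
  qed
  show ?thesis
    unfolding tangent_cone_def mem_Collect_eq
  proof (intro exI[of _ "\<lambda>k. t (k + K)"] exI[of _ "\<lambda>k. (u (k + K), Z (k + K))"] conjI allI)
    show "(\<lambda>k. t (k + K)) \<longlonglongrightarrow> 0"
      using t by (simp add: LIMSEQ_ignore_initial_segment)
    show "(\<lambda>k. (u (k + K), Z (k + K))) \<longlonglongrightarrow> (w, hess_lag hq lam x *v w + n)"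
      using u \<open>Z \<longlonglongrightarrow> _\<close> by (intro tendsto_Pair LIMSEQ_ignore_initial_segment)
  qed (use t graph in auto)
qed

lemma graph_deriv_normal_cone:
  assumes x: "x \<in> U" "x \<in> Gamma q E I" and lam: "lam \<in> multipliers q gq I x xs"
  shows "graph_deriv (normal_cone (Gamma q E I)) x xs w =
    {hess_lag hq lam x *v w + n | n. n \<in> normal_cone (critical_cone q E I x xs) w}" (is "_ = ?R")
proof (intro equalityI subsetI)
  fix z assume "z \<in> graph_deriv (normal_cone (Gamma q E I)) x xs w"
  then have "(w, z) \<in> tangent_cone (graph (normal_cone (Gamma q E I))) (x, xs)"
    by (simp add: graph_deriv_def)
  then obtain mu where "mu \<in> multipliers q gq I x xs"
    "z - hess_lag hq mu x *v w \<in> normal_cone (critical_cone q E I x xs) w"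
    using tangent_graph_imp_normal[OF x] by blast
  then have "z - hess_lag hq lam x *v w \<in> normal_cone (critical_cone q E I x xs) w"
    using normal_shift_multiplier_independent[OF x lam] by blast
  then show "z \<in> ?R"
    by (intro CollectI exI[of _ "z - hess_lag hq lam x *v w"]) simp
next
  fix z assume "z \<in> ?R"
  then show "z \<in> graph_deriv (normal_cone (Gamma q E I)) x xs w"
    using normal_imp_tangent_graph[OF x lam] by (auto simp: graph_deriv_def)
qed

end

text \<open>A constraint inactive at \<open>xb\<close> stays inactive nearby, so active sets can
  only shrink. Rank constancy for subsets of the active set at \<open>xb\<close> thus covers every
  family needed at a nearby \<open>x\<close>, and the multiplier bound is applied with
  \<open>M\<close> the active set at \<open>x\<close>.\<close>

lemma RCRCQ_neighbourhood:
  fixes q :: "'m::finite \<Rightarrow> real^'n \<Rightarrow> real"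
  assumes sys: "constraint_system q gq hq E I" and rcrcq: "RCRCQ q gq E I xb"
  obtains U \<gamma> where "xb \<in> U" "rcrcq_neighbourhood q gq hq E I U \<gamma>"
proof -
  interpret constraint_system q gq hq E I by fact
  define N where "N = active_set q I xb"
  obtain V where V: "open V" "xb \<in> V" and rank: "\<forall>J. J \<subseteq> N \<longrightarrow> (\<forall>x\<in>V. \<forall>y\<in>V.
      dim ((\<lambda>i. gq i x) ` (E \<union> J)) = dim ((\<lambda>i. gq i y) ` (E \<union> J)))"
    using rcrcq unfolding RCRCQ_def N_def by (elim conjE exE)
  have rank': "dim ((\<lambda>i. gq i x) ` (E \<union> J)) = dim ((\<lambda>i. gq i xb) ` (E \<union> J))"
    if "J \<subseteq> N" "x \<in> V" for J x
    using rank that V(2) by blast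
  have disj: "E \<inter> N = {}"
    using partition by (auto simp: N_def active_set_def)
  define good where "good \<gamma> x \<longleftrightarrow> (\<forall>M lam. M \<subseteq> N \<longrightarrow> (\<forall>i. i \<notin> E \<union> M \<longrightarrow> lam $ i = 0) \<longrightarrow>
      (\<forall>i\<in>M. lam $ i \<ge> 0) \<longrightarrow>
       (\<exists>\<mu>::real^'m. (\<Sum>i\<in>UNIV. \<mu> $ i *\<^sub>R gq i x) = (\<Sum>i\<in>UNIV. lam $ i *\<^sub>R gq i x) \<and>
          (\<forall>i. i \<notin> E \<union> M \<longrightarrow> \<mu> $ i = 0) \<and> (\<forall>i\<in>M. \<mu> $ i \<ge> 0) \<and>
          norm \<mu> \<le> \<gamma> * norm (\<Sum>i\<in>UNIV. lam $ i *\<^sub>R gq i x)))" for \<gamma> x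
  obtain \<gamma> where \<gamma>: "\<gamma> > 0" and bound: "\<forall>\<^sub>F x in nhds xb. good \<gamma> x"
    unfolding good_def
    by (rule bounded_multipliers[of V xb E N gq, OF V disj rank' gq_continuous])
  have "\<forall>\<^sub>F x in nhds xb. \<forall>i\<in>UNIV. q i xb \<noteq> 0 \<longrightarrow> q i x \<noteq> 0"
  proof (intro eventually_ball_finite ballI finite)
    fix i
    have "(q i \<longlongrightarrow> q i xb) (nhds xb)"
      using q_continuous[of xb i] by (simp add: isCont_def tendsto_nhds_iff)
    then show "\<forall>\<^sub>F x in nhds xb. q i xb \<noteq> 0 \<longrightarrow> q i x \<noteq> 0"
      by (cases "q i xb = 0") (auto dest: tendsto_imp_eventually_ne)
  qed
  from eventually_conj[OF bound this] obtain U0 where U0: "open U0" "xb \<in> U0"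
    and bound: "\<And>x. x \<in> U0 \<Longrightarrow> good \<gamma> x" and act: "\<And>x i. x \<in> U0 \<Longrightarrow> q i xb \<noteq> 0 \<Longrightarrow> q i x \<noteq> 0"
    unfolding eventually_nhds by blast
  have act: "active_set q I x \<subseteq> N" if "x \<in> U0" for x
    using act[OF that] by (auto simp: active_set_def N_def)
  have "rcrcq_neighbourhood q gq hq E I (U0 \<inter> V) \<gamma>"
  proof
    show "open (U0 \<inter> V)" using U0 V by auto
    show "dim ((\<lambda>i. gq i y) ` (E \<union> J)) = dim ((\<lambda>i. gq i x) ` (E \<union> J))"
      if "x \<in> U0 \<inter> V" "J \<subseteq> active_set q I x" "y \<in> U0 \<inter> V" for x y J
      using rank act[of x] that by blast
    fix x xs
    assume x: "x \<in> U0 \<inter> V" and "multipliers q gq I x xs \<noteq> {}"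
    then obtain lam where lam: "lam \<in> multipliers q gq I x xs" by blast
    let ?M = "active_set q I x"
    have "?M \<subseteq> N"
      using act x by simp
    moreover have "\<forall>i. i \<notin> E \<union> ?M \<longrightarrow> lam $ i = 0"
      using multipliers_active(1)[OF lam] E_or_I by blast
    moreover have "\<forall>i\<in>?M. lam $ i \<ge> 0"
      using lam by (auto simp: multipliers_def active_set_def)
    moreover have "(\<Sum>i\<in>UNIV. lam $ i *\<^sub>R gq i x) = xs"
      using lam by (simp add: multipliers_def)
    ultimately obtain \<mu> :: "real^'m" where \<mu>: "(\<Sum>i\<in>UNIV. \<mu> $ i *\<^sub>R gq i x) = xs"
      "\<forall>i. i \<notin> E \<union> ?M \<longrightarrow> \<mu> $ i = 0" "\<forall>i\<in>?M. \<mu> $ i \<ge> 0" "norm \<mu> \<le> \<gamma> * norm xs"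
      using bound[of x, unfolded good_def, rule_format, of ?M lam] x by auto
    have "\<mu> $ i \<ge> 0 \<and> \<mu> $ i * q i x = 0" if "i \<in> I" for i
      using \<mu>(2,3) that partition by (cases "i \<in> ?M") (auto simp: active_set_def)
    then have "\<mu> \<in> multipliers q gq I x xs"
      using \<mu>(1) by (simp add: multipliers_def)
    with \<mu>(4) show "\<exists>lam\<in>multipliers q gq I x xs. norm lam \<le> \<gamma> * norm xs" by blast
  qed (rule \<gamma>)
  then show thesis
    using that U0 V by blast
qed

theorem theorem3p1:
  fixes q :: "'m::finite \<Rightarrow> real^'n \<Rightarrow> real"
    and gq :: "'m \<Rightarrow> real^'n \<Rightarrow> real^'n"
    and hq :: "'m \<Rightarrow> real^'n \<Rightarrow> real^'n^'n"
    and E I :: "'m set"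
    and xb :: "real^'n"
  assumes partition: "E \<inter> I = {}" "E \<union> I = UNIV"
    and grad: "\<And>i x. (q i has_derivative (\<lambda>h. inner (gq i x) h)) (at x)"
    and hess: "\<And>i x. (gq i has_derivative (\<lambda>h. hq i x *v h)) (at x)"
    and hess_cont: "\<And>i. continuous_on UNIV (hq i)"
    and xb_in: "xb \<in> Gamma q E I"
    and rcrcq: "RCRCQ q gq E I xb"
  shows "\<exists>U \<gamma>. open U \<and> xb \<in> U \<and> \<gamma> > 0 \<and>
    (\<forall>x \<in> Gamma q E I \<inter> U. MSCQ q E I \<gamma> x) \<and>
    (\<forall>x \<in> Gamma q E I \<inter> U. \<forall>xs v.
        (\<forall>i \<in> E \<union> Iplus q gq I x xs. inner (gq i x) v = 0) \<longrightarrow>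
        multipliers_dir q gq hq I x xs v = multipliers q gq I x xs) \<and>
    (\<forall>x \<in> Gamma q E I \<inter> U. \<forall>xs. \<forall>lam \<in> multipliers q gq I x xs.
        tangent_cone (graph (normal_cone (Gamma q E I))) (x, xs) =
          {(w, z). z \<in> {hess_lag hq lam x *v w + n | n. n \<in> normal_cone (critical_cone q E I x xs) w}} \<and>
        (\<forall>w. graph_deriv (normal_cone (Gamma q E I)) x xs w =
          {hess_lag hq lam x *v w + n | n. n \<in> normal_cone (critical_cone q E I x xs) w})) \<and>
    (\<forall>x \<in> Gamma q E I \<inter> U. \<forall>xs. multipliers q gq I x xs \<noteq> {} \<longrightarrow>
        (\<exists>lam \<in> multipliers q gq I x xs. norm lam \<le> \<gamma> * norm xs \<and>
          (\<forall>w z. z \<in> graph_deriv (normal_cone (Gamma q E I)) x xs w \<longrightarrow>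
             z \<in> {hess_lag hq lam x *v w + n | n. n \<in> normal_cone (critical_cone q E I x xs) w})))"
proof -
  have "constraint_system q gq hq E I"
    using partition grad hess by unfold_locales
  then obtain U0 \<gamma>0 where xb: "xb \<in> U0" and "rcrcq_neighbourhood q gq hq E I U0 \<gamma>0"
    using RCRCQ_neighbourhood rcrcq by blast
  then interpret rcrcq_neighbourhood q gq hq E I U0 \<gamma>0 by simp
  obtain W where W: "open W" "xb \<in> W"
    "\<And>u. u \<in> W \<Longrightarrow> infdist u (Gamma q E I) \<le> 2 * \<gamma>0 * infdist (qvec q u) (Theta E I)"
    using metric_subregularity[OF xb xb_in] by blast
  \<comment> \<open>\<open>W\<close> is a neighbourhood of each of its points, so one subregularity
    estimate serves all of them. The modulus \<open>2 * \<gamma>0\<close> from that estimate also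
    covers the multiplier bound, which holds already with \<open>\<gamma>0\<close>.\<close>
  show ?thesis
  proof (intro exI[of _ "U0 \<inter> W"] exI[of _ "2 * \<gamma>0"] conjI ballI allI impI)
    show "open (U0 \<inter> W)" "xb \<in> U0 \<inter> W" "2 * \<gamma>0 > 0"
      using U W xb \<gamma> by auto
    show "MSCQ q E I (2 * \<gamma>0) x" if "x \<in> Gamma q E I \<inter> (U0 \<inter> W)" for x
      unfolding MSCQ_def using that W \<gamma> by auto
    show "multipliers_dir q gq hq I x xs v = multipliers q gq I x xs"
      if x: "x \<in> Gamma q E I \<inter> (U0 \<inter> W)" and v: "\<forall>i\<in>E \<union> Iplus q gq I x xs. inner (gq i x) v = 0" for x xs v
    proof -
      have "inner v (hess_lag hq mu x *v v) \<le> inner v (hess_lag hq lam x *v v)"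
        if lm: "lam \<in> multipliers q gq I x xs" "mu \<in> multipliers q gq I x xs" for lam mu
      proof -
        have "inner (hess_lag hq mu x *v v) v = inner (hess_lag hq lam x *v v) v"
          using that hess_lag_multiplier_independent[OF _ _ lm(2,1), of v v] x v by blast
        then show ?thesis by (simp add: inner_commute)
      qed
      then show ?thesis
        unfolding multipliers_dir_def by blast
    qed
    show deriv: "graph_deriv (normal_cone (Gamma q E I)) x xs w =
          {hess_lag hq lam x *v w + n | n. n \<in> normal_cone (critical_cone q E I x xs) w}"
      if "x \<in> Gamma q E I \<inter> (U0 \<inter> W)" "lam \<in> multipliers q gq I x xs" for x xs lam w
      using graph_deriv_normal_cone[of x lam xs w] that by blast
    show "tangent_cone (graph (normal_cone (Gamma q E I))) (x, xs) =
          {(w, z). z \<in> {hess_lag hq lam x *v w + n | n. n \<in> normal_cone (critical_cone q E I x xs) w}}"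
      if "x \<in> Gamma q E I \<inter> (U0 \<inter> W)" "lam \<in> multipliers q gq I x xs" for x xs lam
      unfolding deriv[OF that, symmetric] by (auto simp: graph_deriv_def)
    show "\<exists>lam \<in> multipliers q gq I x xs. norm lam \<le> 2 * \<gamma>0 * norm xs \<and>
          (\<forall>w z. z \<in> graph_deriv (normal_cone (Gamma q E I)) x xs w \<longrightarrow>
             z \<in> {hess_lag hq lam x *v w + n | n. n \<in> normal_cone (critical_cone q E I x xs) w})"
      if x: "x \<in> Gamma q E I \<inter> (U0 \<inter> W)" and ne: "multipliers q gq I x xs \<noteq> {}" for x xs
    proof -
      obtain lam where lam: "lam \<in> multipliers q gq I x xs" "norm lam \<le> \<gamma>0 * norm xs"
        using bounded[of x xs] x ne by blast
      moreover have "\<gamma>0 * norm xs \<ge> 0" using \<gamma> by simp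
      ultimately have "norm lam \<le> 2 * \<gamma>0 * norm xs" by linarith
      then show ?thesis
        using lam(1) deriv[OF x lam(1)] by blast
    qed
  qed
qed

end
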